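(* The double factorial Schur functions $s_\lambda(\mathbf p\,\|\,\boldsymbol\alpha;\boldsymbol\beta)=\langle\varnothing|e^{H_+(\mathbf p|\boldsymbol\alpha;\boldsymbol\beta)}|\lambda\rangle$ are the generalized factorial Schur functions of Miyaura--Mukaihira (with their parameters $a_i=\beta_i$, $b_i=\alpha_i$); that is, for every $n\ge1$ they are the coefficients in the expansion $$\sum_{\lambda\in\mathbb Z^n}s_\lambda(\mathbf p\,\|\,\boldsymbol\alpha;\boldsymbol\beta)\prod_{i=1}^n\frac{(z_i|\sigma^{-i}\boldsymbol\beta)^{\lambda_i}}{(z_i;\sigma^{1-i}\boldsymbol\alpha)^{\lambda_i}}=e^{\Lambda_{-n}(\mathbf p|\boldsymbol\beta)}\prod_{i=1}^n e^{\xi(\mathbf p;z_i)}\,\frac{(z_i|\boldsymbol\beta)^{-n}\,(z_i;\boldsymbol\alpha)^{1-i}}{(z_i|\boldsymbol\beta)^{-i}}\prod_{1\le i<j\le n}(z_i-z_j)(1-\alpha_{1-i}\beta_{1-j}).$$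
   Context: $\boldsymbol\alpha=(\alpha_i)_{i\in\mathbb Z}$, $\boldsymbol\beta=(\beta_i)_{i\in\mathbb Z}$ are sequences in $\mathbb C$. For $k\in\mathbb Z$, $(z;\boldsymbol\alpha)^k=\prod_{i=1}^k(1-z\alpha_i)$ if $k\ge 0$ and $\prod_{i=k+1}^{0}(1-z\alpha_i)^{-1}$ if $k<0$; $(z|\boldsymbol\beta)^k=\prod_{i=1}^k(z-\beta_i)$ if $k\ge0$ and $\prod_{i=k+1}^0(z-\beta_i)^{-1}$ if $k<0$. $(\sigma^a\boldsymbol\alpha)_i=\alpha_{i+a}$, likewise for $\boldsymbol\beta$. Coefficients with respect to shifted powers are extracted by contour integrals over $|z_i|=r$ with $|\beta_a|<r<|\alpha_b^{-1}|$ for all $a,b$. The Clifford algebra is generated by $\psi_i,\psi_i^*$ ($i\in\mathbb Z$) with $[\psi_i,\psi_j]_+=[\psi_i^*,\psi_j^*]_+=0$, $[\psi_i,\psi_j^*]_+=\delta_{ij}$. The charge $m$ Fock space has basis $|\lambda\rangle_m=v_{m+\lambda_1}\wedge v_{m-1+\lambda_2}\wedge\cdots$ ($\lambda$ a partition); $\psi_j$ acts by $v_j\wedge$, $\psi_j^*$ by contraction against $v_j$; ${}_m\langle\lambda|$ is the dual basis, and $m=0$ is omitted. For $\lambda\in\mathbb Z^n$ (not necessarily a partition), $|\lambda\rangle=\psi_{\lambda_1}\psi_{\lambda_2-1}\cdots\psi_{\lambda_n-n+1}|\varnothing\rangle_{-n}$. Normal ordering: $:\!\psi_i\psi_j^*\!:\,=\psi_i\psi_j^*$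 if $i>0$, $=-\psi_j^*\psi_i$ if $i\le0$. Deformed currents for $k>0$: $J_k^{(\boldsymbol\alpha;\boldsymbol\beta)}=\sum_{i,j}A_{ij}^k:\!\psi_i\psi_j^*\!:$, the coefficient of $z^{-k}$ in $:\!\psi(z|\boldsymbol\alpha;\boldsymbol\beta)\psi^*(z|\boldsymbol\alpha;\boldsymbol\beta)\!:$ (expanded for $|\beta_a|<|z|<|\alpha_b^{-1}|$), where $\psi(z|\boldsymbol\alpha;\boldsymbol\beta)=\sum_i z\frac{(z|\boldsymbol\beta)^{i-1}}{(z;\boldsymbol\alpha)^i}\psi_i$, $\psi^*(w|\boldsymbol\alpha;\boldsymbol\beta)=\sum_j(1-\alpha_j\beta_j)\frac{(w;\boldsymbol\alpha)^{j-1}}{(w|\boldsymbol\beta)^j}\psi_j^*$; explicitly $A_{ii}^k=\beta_i^k$, $A_{ij}^k=0$ for $j<i$, and $A_{ij}^k=(1-\alpha_j\beta_j)\sum_{r-s=j-i-k}e_r(-\alpha_{i+1},\dots,-\alpha_{j-1})h_s(\beta_i,\dots,\beta_j)$ for $j>i$, with $e_r,h_s$ elementary and complete homogeneous symmetric polynomials. $H_+(\mathbf p|\boldsymbol\alpha;\boldsymbol\beta)=\sum_{k\ge1}\frac{p_k}{k}J_k^{(\boldsymbol\alpha;\boldsymbol\beta)}$, with $\mathbf p=(p_1,p_2,\dots)$ indeterminates. $\xi(\mathbf p;z)=\sum_{k\ge1}\frac{p_k}{k}z^k$ and $\Lambda_{-n}(\mathbf p|\boldsymbol\beta)=-\sum_{j=1-n}^{0}\sum_{k\ge1}\frac{p_k}{k}\beta_j^k$.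 The displayed expansion is the generating function by which Miyaura--Mukaihira's generalized factorial Schur functions are given. *)

theory Defs
  imports
    "HOL-Complex_Analysis.Complex_Analysis"
    "HOL-Library.Multiset"
    "HOL-Library.Poly_Mapping"
    "HOL-Library.Groups_Big_Fun"
begin

section \<open>Shifted powers\<close>

definition shift :: "int \<Rightarrow> (int \<Rightarrow> complex) \<Rightarrow> int \<Rightarrow> complex"
  where "shift a s = (\<lambda>i. s (i + a))"

text \<open>\<open>mpow z \<alpha> k\<close> is \<open>(z;\<alpha>)\<^sup>k\<close> and \<open>apow z \<beta> k\<close> is \<open>(z|\<beta>)\<^sup>k\<close>.\<close>

definition mpow :: "complex \<Rightarrow> (int \<Rightarrow> complex) \<Rightarrow> int \<Rightarrow> complex"
  where "mpow z \<alpha> k =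
    (if 0 \<le> k then \<Prod>i=1..k. 1 - z * \<alpha> i else \<Prod>i=k+1..0. inverse (1 - z * \<alpha> i))"

definition apow :: "complex \<Rightarrow> (int \<Rightarrow> complex) \<Rightarrow> int \<Rightarrow> complex"
  where "apow z \<beta> k =
    (if 0 \<le> k then \<Prod>i=1..k. z - \<beta> i else \<Prod>i=k+1..0. inverse (z - \<beta> i))"

section \<open>Extraction of coefficients with respect to shifted powers\<close>

definition shifted_basis :: "(int \<Rightarrow> complex) \<Rightarrow> (int \<Rightarrow> complex) \<Rightarrow> int \<Rightarrow> complex \<Rightarrow> complex"
  where "shifted_basis a b k z = apow z b k / mpow z a k"

text \<open>
  The family dual to \<^term>\<open>shifted_basis a b\<close> under the pairing
  \<open>(f, g) \<mapsto> (1 / 2\<pi>i) \<oint> f g dz\<close> over \<open>|z| = r\<close>; see \<open>shifted_biorthogonal\<close> below.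
\<close>

definition shifted_dual :: "(int \<Rightarrow> complex) \<Rightarrow> (int \<Rightarrow> complex) \<Rightarrow> int \<Rightarrow> complex \<Rightarrow> complex"
  where "shifted_dual a b k z = (1 - a k * b (k + 1)) * mpow z a (k - 1) / apow z b (k + 1)"

lemma mpow_Suc:
  assumes "\<And>i. 1 - z * a i \<noteq> 0"
  shows "mpow z a (k + 1) = mpow z a k * (1 - z * a (k + 1))"
proof (cases "k \<ge> 0")
  case True
  have "{1..k+1} = insert (k+1) {1..k}" using True by auto
  then show ?thesis using True by (simp add: mpow_def)
next
  case False
  have "{k+1..0} = insert (k+1) {k+1+1..0}" using False by auto
  then show ?thesis using False assms by (auto simp: mpow_def)
qed

lemma apow_Suc:
  assumes "\<And>i. z - b i \<noteq> 0"
  shows "apow z b (k + 1) = apow z b k * (z - b (k + 1))"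
proof (cases "k \<ge> 0")
  case True
  have "{1..k+1} = insert (k+1) {1..k}" using True by auto
  then show ?thesis using True by (simp add: apow_def)
next
  case False
  have "{k+1..0} = insert (k+1) {k+1+1..0}" using False by auto
  then show ?thesis using False assms by (auto simp: apow_def)
qed

lemma mpow_add:
  assumes "\<And>i. 1 - z * a i \<noteq> 0"
  shows "mpow z a (k + int m) = mpow z a k * (\<Prod>i=k+1..k+int m. 1 - z * a i)"
proof (induction m)
  case (Suc m)
  have "{k+1..k+int (Suc m)} = insert (k + int m + 1) {k+1..k+int m}" by auto
  then show ?case
    using Suc mpow_Suc[OF assms, where k = "k + int m"] by (simp add: add_ac mult_ac)
qed auto

lemma apow_add:
  assumes "\<And>i. z - b i \<noteq> 0"
  shows "apow z b (k + int m) = apow z b k * (\<Prod>i=k+1..k+int m. z - b i)"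
proof (induction m)
  case (Suc m)
  have "{k+1..k+int (Suc m)} = insert (k + int m + 1) {k+1..k+int m}" by auto
  then show ?case
    using Suc apow_Suc[OF assms, where k = "k + int m"] by (simp add: add_ac mult_ac)
qed auto

lemma mpow_nonzero: "(\<And>i. 1 - z * a i \<noteq> 0) \<Longrightarrow> mpow z a k \<noteq> 0"
  by (simp add: mpow_def)

lemma apow_nonzero: "(\<And>i. z - b i \<noteq> 0) \<Longrightarrow> apow z b k \<noteq> 0"
  by (simp add: apow_def)

lemma contour_integral_circlepath_inverse:
  assumes "0 < r"
  shows "contour_integral (circlepath 0 r) f =
         contour_integral (circlepath 0 (1 / r)) (\<lambda>u. f (1 / u) / u\<^sup>2)"
proof -
  let ?e = "\<lambda>x. exp (2 * of_real pi * \<i> * of_real x) :: complex"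
  define h where "h x = f (r * ?e x) * (2 * pi * \<i> * r * ?e x)" for x
  have "contour_integral (circlepath 0 r) f = integral {0..1} h"
    unfolding contour_integral_integral vector_derivative_circlepath h_def
    by (simp add: circlepath)
  also have "\<dots> = integral {0..1} (\<lambda>x. h (1 - x))"
    using Henstock_Kurzweil_Integration.integral_reflect_real [of 1 0 h]
      integral_shift_real_ivl [of "-1" "-1" 0 "\<lambda>x. h (- x)"] by (simp add: add.commute)
  also have "\<dots> = contour_integral (circlepath 0 (1 / r)) (\<lambda>u. f (1 / u) / u\<^sup>2)"
    unfolding contour_integral_integral vector_derivative_circlepath
  proof (rule Henstock_Kurzweil_Integration.integral_cong)
    fix x :: real
    have e: "?e (1 - x) = inverse (?e x)"
      by (simp add: exp_minus [symmetric] right_diff_distrib exp_diff inverse_eq_divide)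
    show "h (1 - x) = f (1 / circlepath 0 (1 / r) x) / (circlepath 0 (1 / r) x)\<^sup>2 *
            (complex_of_real (2 * pi) * \<i> * complex_of_real (1 / r) * ?e x)"
      unfolding h_def e using assms
      by (simp add: circlepath field_simps power2_eq_square)
  qed
  finally show ?thesis .
qed

lemma shifted_biorthogonal:
  assumes b: "\<And>i. cmod (b i) < r" and a: "\<And>i. cmod (a i) * r < 1"
  shows "contour_integral (circlepath 0 r) (\<lambda>z. shifted_basis a b j z * shifted_dual a b k z)
           / (2 * of_real pi * \<i>) = (if j = k then 1 else 0)"
proof -
  have r: "0 < r" using b [of 0] by (meson norm_ge_zero order_le_less_trans)
  have nza: "1 - z * a i \<noteq> 0" if "cmod z \<le> r" for z i
  proof
    assume "1 - z * a i = 0"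
    then have "cmod z * cmod (a i) = 1" by (metis eq_iff_diff_eq_0 norm_mult norm_one)
    moreover have "cmod z * cmod (a i) \<le> r * cmod (a i)" using that by (simp add: mult_right_mono)
    ultimately show False using a [of i] by (simp add: mult.commute)
  qed
  have nzb: "z - b i \<noteq> 0" if "cmod z = r" for z i using b [of i] that by auto
  let ?c = "1 - a k * b (k + 1)"
  have c: "?c \<noteq> 0" using nza [of "b (k+1)" k] b [of "k+1"] by (simp add: mult.commute)
  have cong: "contour_integral (circlepath 0 r) (\<lambda>z. shifted_basis a b j z * shifted_dual a b k z) =
      contour_integral (circlepath 0 r) g"
    if "\<And>z. cmod z = r \<Longrightarrow> shifted_basis a b j z * shifted_dual a b k z = g z" for g
    by (rule contour_integral_cong) (use that r in \<open>auto simp: path_image_circlepath_nonneg\<close>)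
  consider "j = k" | "j > k" | "j < k" by linarith
  then show ?thesis
  proof cases
    case 1
    have "contour_integral (circlepath 0 r) (\<lambda>z. shifted_basis a b j z * shifted_dual a b k z) =
      contour_integral (circlepath 0 r) (\<lambda>z. ?c / (1 - z * a k) / (z - b (k + 1)))"
    proof (rule cong)
      fix z :: complex assume z: "cmod z = r"
      have A: "\<And>i. 1 - z * a i \<noteq> 0" and B: "\<And>i. z - b i \<noteq> 0" using nza nzb z by auto
      show "shifted_basis a b j z * shifted_dual a b k z = ?c / (1 - z * a k) / (z - b (k + 1))"
        using mpow_Suc [of z a "k - 1"] apow_Suc [of z b k] A B
          mpow_nonzero [of z a "k - 1"] apow_nonzero [of z b k] 1
        by (simp add: shifted_basis_def shifted_dual_def)
    qed
    also have "\<dots> = 2 * of_real pi * \<i> * (?c / (1 - b (k + 1) * a k))"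
      by (rule contour_integral_unique, rule Cauchy_integral_circlepath_simple)
         (use b nza in \<open>auto intro!: holomorphic_intros\<close>)
    finally show ?thesis using 1 c by (simp add: mult.commute)
  next
    case 2
    define m where "m = nat (j - k - 1)"
    have m: "j = k + 1 + int m" "j = k - 1 + int (m + 2)" using 2 by (auto simp: m_def)
    have "contour_integral (circlepath 0 r) (\<lambda>z. shifted_basis a b j z * shifted_dual a b k z) =
      contour_integral (circlepath 0 r) (\<lambda>z. ?c * (\<Prod>i=k+2..j. z - b i) / (\<Prod>i=k..j. 1 - z * a i))"
    proof (rule cong)
      fix z :: complex assume z: "cmod z = r"
      have A: "\<And>i. 1 - z * a i \<noteq> 0" and B: "\<And>i. z - b i \<noteq> 0" using nza nzb z by auto
      have "mpow z a j = mpow z a (k - 1) * (\<Prod>i=k..j. 1 - z * a i)"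
        using mpow_add [of z a "k - 1" "m + 2"] A m by simp
      moreover have "apow z b j = apow z b (k + 1) * (\<Prod>i=k+2..j. z - b i)"
        using apow_add [of z b "k + 1" m, folded m(1)] B by (simp add: add.assoc)
      ultimately show "shifted_basis a b j z * shifted_dual a b k z =
          ?c * (\<Prod>i=k+2..j. z - b i) / (\<Prod>i=k..j. 1 - z * a i)"
        using mpow_nonzero [of z a "k - 1"] apow_nonzero [of z b "k + 1"] A B
        by (simp add: shifted_basis_def shifted_dual_def)
    qed
    also have "\<dots> = 0"
    proof (rule contour_integral_unique, rule Cauchy_theorem_convex_simple)
      show "(\<lambda>z. ?c * (\<Prod>i=k+2..j. z - b i) / (\<Prod>i=k..j. 1 - z * a i)) holomorphic_on cball 0 r"
        using nza by (auto intro!: holomorphic_intros)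
    qed (use r in auto)
    finally show ?thesis using 2 by simp
  next
    case 3
    define m where "m = nat (k - 1 - j)"
    have m: "k - 1 = j + int m" "k + 1 = j + int (m + 2)" using 3 by (auto simp: m_def)
    let ?g = "\<lambda>z. ?c * (\<Prod>i=j+1..k-1. 1 - z * a i) / (\<Prod>i=j+1..k+1. z - b i)"
    have "contour_integral (circlepath 0 r) (\<lambda>z. shifted_basis a b j z * shifted_dual a b k z) =
      contour_integral (circlepath 0 r) ?g"
    proof (rule cong)
      fix z :: complex assume z: "cmod z = r"
      have A: "\<And>i. 1 - z * a i \<noteq> 0" and B: "\<And>i. z - b i \<noteq> 0" using nza nzb z by auto
      have "mpow z a (k - 1) = mpow z a j * (\<Prod>i=j+1..k-1. 1 - z * a i)"
        using mpow_add [of z a j m] A m by simp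
      moreover have "apow z b (k + 1) = apow z b j * (\<Prod>i=j+1..k+1. z - b i)"
        using apow_add [of z b j "m + 2", folded m(2)] B by simp
      ultimately show "shifted_basis a b j z * shifted_dual a b k z = ?g z"
        using mpow_nonzero [of z a j] apow_nonzero [of z b j] A B
        by (simp add: shifted_basis_def shifted_dual_def)
    qed
    also have "\<dots> = contour_integral (circlepath 0 (1 / r)) (\<lambda>u. ?g (1 / u) / u\<^sup>2)"
      using r by (rule contour_integral_circlepath_inverse)
    also have "\<dots> = contour_integral (circlepath 0 (1 / r))
        (\<lambda>u. ?c * (\<Prod>i=j+1..k-1. u - a i) / (\<Prod>i=j+1..k+1. 1 - u * b i))"
    proof (rule contour_integral_cong)
      fix u assume "u \<in> path_image (circlepath 0 (1 / r))"
      then have u: "u \<noteq> 0" using r by (auto simp: path_image_circlepath_nonneg)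
      have "(\<Prod>i=j+1..k-1. 1 - 1 / u * a i) = (\<Prod>i=j+1..k-1. (u - a i) / u)"
        using u by (intro prod.cong) (auto simp: field_simps)
      also have "\<dots> = (\<Prod>i=j+1..k-1. u - a i) / u ^ m"
        using m by (simp add: prod_dividef)
      finally have 1: "(\<Prod>i=j+1..k-1. 1 - 1 / u * a i) = (\<Prod>i=j+1..k-1. u - a i) / u ^ m" .
      have "(\<Prod>i=j+1..k+1. 1 / u - b i) = (\<Prod>i=j+1..k+1. (1 - u * b i) / u)"
        using u by (intro prod.cong) (auto simp: field_simps)
      also have "\<dots> = (\<Prod>i=j+1..k+1. 1 - u * b i) / u ^ (m + 2)"
        using m(2) by (simp add: prod_dividef nat_add_distrib)
      finally have 2: "(\<Prod>i=j+1..k+1. 1 / u - b i) = (\<Prod>i=j+1..k+1. 1 - u * b i) / u ^ (m + 2)" .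
      show "?g (1 / u) / u\<^sup>2 = ?c * (\<Prod>i=j+1..k-1. u - a i) / (\<Prod>i=j+1..k+1. 1 - u * b i)"
        unfolding 1 2 using u by (simp add: power_add power2_eq_square)
    qed auto
    also have "\<dots> = 0"
    proof (rule contour_integral_unique, rule Cauchy_theorem_convex_simple)
      have "1 - u * b i \<noteq> 0" if "cmod u \<le> 1 / r" for u i
      proof
        assume "1 - u * b i = 0"
        then have "cmod u * cmod (b i) = 1" by (metis eq_iff_diff_eq_0 norm_mult norm_one)
        moreover have "cmod u * cmod (b i) \<le> 1 / r * cmod (b i)"
          using that by (intro mult_right_mono) auto
        moreover have "1 / r * cmod (b i) < 1" using b [of i] r by (simp add: field_simps)
        ultimately show False by simp
      qed
      then show "(\<lambda>u. ?c * (\<Prod>i=j+1..k-1. u - a i) / (\<Prod>i=j+1..k+1. 1 - u * b i))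
                   holomorphic_on cball 0 (1 / r)"
        by (auto intro!: holomorphic_intros)
    qed (use r in auto)
    finally show ?thesis using 3 by simp
  qed
qed

section \<open>Formal power series in the indeterminates \<open>p\<^sub>1, p\<^sub>2, \<dots>\<close>\<close>

text \<open>
  The multiset \<open>{#k\<^sub>1, \<dots>, k\<^sub>N#}\<close> encodes the monomial \<open>p\<^bsub>k\<^sub>1\<^esub> \<cdots> p\<^bsub>k\<^sub>N\<^esub>\<close>.
  The coefficients may be noncommutative, but they commute with the indeterminates.
  The index \<open>0\<close> is never used.
\<close>

typedef 'a pser = "UNIV :: (nat multiset \<Rightarrow> 'a) set"
  morphisms pcoeff Abs_pser ..

setup_lifting type_definition_pser

lemma pser_eqI: "(\<And>M. pcoeff F M = pcoeff G M) \<Longrightarrow> F = G"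
  by transfer auto

lemma finite_splits: "finite {(A, B). A + B = (M :: 'b multiset)}"
proof (induction M)
  case empty
  have "{(A, B). A + B = ({#} :: 'b multiset)} = {({#}, {#})}" by auto
  then show ?case by simp
next
  case (add x M)
  let ?S = "{(A, B). A + B = M}"
  have "{(A, B). A + B = add_mset x M} \<subseteq>
        (\<lambda>(A, B). (add_mset x A, B)) ` ?S \<union> (\<lambda>(A, B). (A, add_mset x B)) ` ?S"
  proof
    fix P assume "P \<in> {(A, B). A + B = add_mset x M}"
    then obtain A B where P: "P = (A, B)" "A + B = add_mset x M" by auto
    then have "x \<in># A + B" by simp
    then consider "x \<in># A" | "x \<in># B" by auto
    then show "P \<in> (\<lambda>(A, B). (add_mset x A, B)) ` ?S \<union> (\<lambda>(A, B). (A, add_mset x B)) ` ?S"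
    proof cases
      case 1
      then obtain A' where "A = add_mset x A'" by (metis multi_member_split)
      with P show ?thesis by force
    next
      case 2
      then obtain B' where "B = add_mset x B'" by (metis multi_member_split)
      with P show ?thesis by force
    qed
  qed
  with add show ?case by (meson finite_UnI finite_imageI finite_subset)
qed

instantiation pser :: (ring_1) ring_1
begin

lift_definition zero_pser :: "'a pser" is "\<lambda>_. 0" .
lift_definition one_pser :: "'a pser" is "\<lambda>M. if M = {#} then 1 else 0" .
lift_definition plus_pser :: "'a pser \<Rightarrow> 'a pser \<Rightarrow> 'a pser" is "\<lambda>f g M. f M + g M" .
lift_definition minus_pser :: "'a pser \<Rightarrow> 'a pser \<Rightarrow> 'a pser" is "\<lambda>f g M. f M - g M" .
lift_definition uminus_pser :: "'a pser \<Rightarrow> 'a pser" is "\<lambda>f M. - f M" .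
lift_definition times_pser :: "'a pser \<Rightarrow> 'a pser \<Rightarrow> 'a pser"
  is "\<lambda>f g M. \<Sum>(A, B) | A + B = M. f A * g B" .

instance
proof
  fix F G H :: "'a pser"
  show "F * G * H = F * (G * H)"
  proof transfer
    fix f g h :: "nat multiset \<Rightarrow> 'a"
    show "(\<lambda>M. \<Sum>(A, B) | A + B = M. (\<Sum>(C, D) | C + D = A. f C * g D) * h B) =
          (\<lambda>M. \<Sum>(A, B) | A + B = M. f A * (\<Sum>(C, D) | C + D = B. g C * h D))"
    proof
      fix M :: "nat multiset"
      have "(\<Sum>(A, B) | A + B = M. (\<Sum>(C, D) | C + D = A. f C * g D) * h B) =
        (\<Sum>P\<in>{(A, B). A + B = M}. \<Sum>Q\<in>{(A, B). A + B = fst P}. f (fst Q) * g (snd Q) * h (snd P))"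
        by (simp add: sum_distrib_right case_prod_unfold)
      also have "\<dots> = (\<Sum>(P, Q)\<in>(SIGMA P:{(A, B). A + B = M}. {(A, B). A + B = fst P}).
                        f (fst Q) * g (snd Q) * h (snd P))"
        by (rule sum.Sigma) (auto simp: finite_splits)
      also have "\<dots> = (\<Sum>(P, Q)\<in>(SIGMA P:{(A, B). A + B = M}. {(A, B). A + B = snd P}).
                        f (fst P) * (g (fst Q) * h (snd Q)))"
        by (rule sum.reindex_bij_witness
              [where i = "\<lambda>((A, B), (C, D)). ((A + C, D), (A, C))"
                 and j = "\<lambda>((A, B), (C, D)). ((C, D + B), (D, B))"])
           (auto simp: mult.assoc add.assoc)
      also have "\<dots> = (\<Sum>P\<in>{(A, B). A + B = M}. \<Sum>Q\<in>{(A, B). A + B = snd P}. f (fst P) * (g (fst Q) * h (snd Q)))"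
        by (rule sum.Sigma [symmetric]) (auto simp: finite_splits)
      also have "\<dots> = (\<Sum>(A, B) | A + B = M. f A * (\<Sum>(C, D) | C + D = B. g C * h D))"
        by (simp add: sum_distrib_left case_prod_unfold)
      finally show "(\<Sum>(A, B) | A + B = M. (\<Sum>(C, D) | C + D = A. f C * g D) * h B) =
          (\<Sum>(A, B) | A + B = M. f A * (\<Sum>(C, D) | C + D = B. g C * h D))" .
    qed
  qed
  show "1 * F = F"
  proof transfer
    fix f :: "nat multiset \<Rightarrow> 'a"
    show "(\<lambda>M. \<Sum>(A, B) | A + B = M. (if A = {#} then 1 else 0) * f B) = f"
    proof
      fix M :: "nat multiset"
      have "(\<Sum>(A, B) | A + B = M. (if A = {#} then 1 else 0) * f B) =
            (\<Sum>(A, B)\<in>{({#} :: nat multiset, M)}. (if A = {#} then 1 else 0) * f B)"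
        by (rule sum.mono_neutral_right) (auto simp: finite_splits split: if_splits)
      then show "(\<Sum>(A, B) | A + B = M. (if A = {#} then 1 else 0) * f B) = f M" by simp
    qed
  qed
  show "F * 1 = F"
  proof transfer
    fix f :: "nat multiset \<Rightarrow> 'a"
    show "(\<lambda>M. \<Sum>(A, B) | A + B = M. f A * (if B = {#} then 1 else 0)) = f"
    proof
      fix M :: "nat multiset"
      have "(\<Sum>(A, B) | A + B = M. f A * (if B = {#} then 1 else 0)) =
            (\<Sum>(A, B)\<in>{(M, {#} :: nat multiset)}. f A * (if B = {#} then 1 else 0))"
        by (rule sum.mono_neutral_right) (auto simp: finite_splits split: if_splits)
      then show "(\<Sum>(A, B) | A + B = M. f A * (if B = {#} then 1 else 0)) = f M" by simp
    qed
  qed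
  show "(F + G) * H = F * H + G * H"
    by transfer (simp add: fun_eq_iff case_prod_unfold distrib_right sum.distrib)
  show "F * (G + H) = F * G + F * H"
    by transfer (simp add: fun_eq_iff case_prod_unfold distrib_left sum.distrib)
  show "(0 :: 'a pser) \<noteq> 1"
    by transfer (auto simp: fun_eq_iff)
  show "F + G = G + F" by transfer (simp add: add.commute)
  show "F + G + H = F + (G + H)" by transfer (simp add: add.assoc)
  show "0 + F = F" "- F + F = 0" "F - G = F + - G" by (transfer; simp)+
qed

end

instance pser :: (comm_ring_1) comm_ring_1
proof
  fix F G :: "'a pser"
  show "F * G = G * F"
  proof transfer
    fix f g :: "nat multiset \<Rightarrow> 'a"
    have "(\<Sum>(A, B) | A + B = M. f A * g B) = (\<Sum>(A, B) | A + B = M. g A * f B)" for M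
      by (rule sum.reindex_bij_witness [where i = prod.swap and j = prod.swap])
         (auto simp: add.commute mult.commute)
    then show "(\<lambda>M. \<Sum>(A, B) | A + B = M. f A * g B) = (\<lambda>M. \<Sum>(A, B) | A + B = M. g A * f B)"
      by auto
  qed
qed (simp_all add: distrib_right)

lift_definition pser_map :: "('a \<Rightarrow> 'b) \<Rightarrow> 'a pser \<Rightarrow> 'b pser" is "\<lambda>h f M. h (f M)" .

lift_definition pconst :: "'a::zero \<Rightarrow> 'a pser" is "\<lambda>c M. if M = {#} then c else 0" .

text \<open>
  Infinite sums are formed coefficientwise; they are used only where every coefficient receives
  finitely many nonzero contributions.
\<close>

lift_definition pser_sum :: "(nat \<Rightarrow> 'a::comm_monoid_add pser) \<Rightarrow> 'a pser"
  is "\<lambda>f M. Sum_any (\<lambda>i. f i M)" .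

text \<open>\<open>pvar_scaled k c\<close> is \<open>c p\<^sub>k\<close>.\<close>

lift_definition pvar_scaled :: "nat \<Rightarrow> 'a::zero \<Rightarrow> 'a pser"
  is "\<lambda>k c M. if M = {#k#} then c else 0" .

text \<open>\<open>plinear c\<close> is \<open>\<Sum>\<^bsub>k\<ge>1\<^esub> (p\<^sub>k / k) c\<^sub>k\<close>.\<close>

definition plinear :: "(nat \<Rightarrow> 'a::real_vector) \<Rightarrow> 'a pser"
  where "plinear c = pser_sum (\<lambda>i. pvar_scaled (Suc i) (c (Suc i) /\<^sub>R real (Suc i)))"

text \<open>\<open>\<Sum>\<^sub>N F\<^sup>N / N!\<close>, for series \<open>F\<close> without constant term.\<close>

definition pexp :: "'a::real_algebra_1 pser \<Rightarrow> 'a pser"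
  where "pexp F = pser_sum (\<lambda>N. pser_map (\<lambda>x. x /\<^sub>R fact N) (F ^ N))"

section \<open>Fermionic Fock space\<close>

text \<open>
  The basis vector \<open>|\<lambda>\<rangle>\<^sub>m = v\<^bsub>m+\<lambda>\<^sub>1\<^esub> \<and> v\<^bsub>m-1+\<lambda>\<^sub>2\<^esub> \<and> \<cdots>\<close> is encoded by the set of its (strictly decreasing)
  indices. The sets that occur, for all charges \<open>m\<close> together, are those that contain only
  finitely many positive and omit only finitely many nonpositive integers. Thus \<open>fock\<close> is the
  direct sum of the charge \<open>m\<close> Fock spaces.
\<close>

typedef maya = "{S :: int set. finite {i \<in> S. 0 < i} \<and> finite {i. i \<le> 0 \<and> i \<notin> S}}"
  morphisms occupied Abs_maya
  by (rule exI [of _ "{..0}"]) (auto intro: finite_subset [of _ "{}"])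

setup_lifting type_definition_maya

lift_definition maya_insert :: "int \<Rightarrow> maya \<Rightarrow> maya" is insert
proof -
  fix j :: int and S :: "int set"
  assume *: "finite {i \<in> S. 0 < i} \<and> finite {i. i \<le> 0 \<and> i \<notin> S}"
  have "{i \<in> insert j S. 0 < i} \<subseteq> insert j {i \<in> S. 0 < i}"
       "{i. i \<le> 0 \<and> i \<notin> insert j S} \<subseteq> {i. i \<le> 0 \<and> i \<notin> S}" by auto
  with * show "finite {i \<in> insert j S. 0 < i} \<and> finite {i. i \<le> 0 \<and> i \<notin> insert j S}"
    by (meson finite_insert finite_subset)
qed

lift_definition maya_remove :: "int \<Rightarrow> maya \<Rightarrow> maya" is "\<lambda>j S. S - {j}"
proof -
  fix j :: int and S :: "int set"
  assume *: "finite {i \<in> S. 0 < i} \<and> finite {i. i \<le> 0 \<and> i \<notin> S}"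
  have "{i \<in> S - {j}. 0 < i} \<subseteq> {i \<in> S. 0 < i}"
       "{i. i \<le> 0 \<and> i \<notin> S - {j}} \<subseteq> insert j {i. i \<le> 0 \<and> i \<notin> S}" by auto
  with * show "finite {i \<in> S - {j}. 0 < i} \<and> finite {i. i \<le> 0 \<and> i \<notin> S - {j}}"
    by (meson finite_insert finite_subset)
qed

text \<open>The diagram of \<open>|\<emptyset>\<rangle>\<^sub>m\<close>.\<close>

lift_definition maya_vacuum :: "int \<Rightarrow> maya" is "\<lambda>m. {..m}"
proof -
  fix m :: int
  have "{i \<in> {..m}. 0 < i} \<subseteq> {0..m}" "{i. i \<le> 0 \<and> i \<notin> {..m}} \<subseteq> {m..0}" by auto
  then show "finite {i \<in> {..m}. 0 < i} \<and> finite {i. i \<le> 0 \<and> i \<notin> {..m}}"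
    by (meson finite_atLeastAtMost_int finite_subset)
qed

lifting_forget maya.lifting

type_synonym fock = "maya \<Rightarrow>\<^sub>0 complex"

lift_definition fock_scale :: "complex \<Rightarrow> fock \<Rightarrow> fock" is "\<lambda>c v S. c * v S"
  by (rule finite_subset [rotated], assumption) auto

interpretation fock: vector_space fock_scale
  by standard (transfer; simp add: fun_eq_iff algebra_simps)+

interpretation fock_pair: vector_space_pair fock_scale fock_scale ..

definition fock_basis :: "maya \<Rightarrow> fock"
  where "fock_basis S = Poly_Mapping.single S 1"

typedef fock_op = "{T. Vector_Spaces.linear fock_scale fock_scale T}"
  morphisms app Abs_fock_op
  using fock.linear_id by blast

setup_lifting type_definition_fock_op

lemma app_linear: "Vector_Spaces.linear fock_scale fock_scale (app T)"
  using app by auto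

lemma fock_op_eqI: "(\<And>v. app S v = app T v) \<Longrightarrow> S = T"
  by (metis app_inject ext)

instantiation fock_op :: real_algebra_1
begin

lift_definition zero_fock_op :: fock_op is "\<lambda>_. 0"
  by (rule fock_pair.linear_zero)
lift_definition one_fock_op :: fock_op is "\<lambda>v. v"
  by (rule fock.linear_ident)
lift_definition plus_fock_op :: "fock_op \<Rightarrow> fock_op \<Rightarrow> fock_op" is "\<lambda>S T v. S v + T v"
  by (rule fock_pair.linear_compose_add)
lift_definition minus_fock_op :: "fock_op \<Rightarrow> fock_op \<Rightarrow> fock_op" is "\<lambda>S T v. S v - T v"
  by (rule fock_pair.linear_compose_sub)
lift_definition uminus_fock_op :: "fock_op \<Rightarrow> fock_op" is "\<lambda>T v. - T v"
  by (rule fock_pair.linear_compose_neg)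
lift_definition times_fock_op :: "fock_op \<Rightarrow> fock_op \<Rightarrow> fock_op" is "\<lambda>S T v. S (T v)"
  using Vector_Spaces.linear_compose unfolding o_def by blast
lift_definition scaleR_fock_op :: "real \<Rightarrow> fock_op \<Rightarrow> fock_op"
  is "\<lambda>c T v. fock_scale (complex_of_real c) (T v)"
  by (rule fock_pair.linear_compose_scale_right)

instance
proof
  have "app 0 (fock_basis (maya_vacuum 0)) \<noteq> app 1 (fock_basis (maya_vacuum 0))"
    unfolding zero_fock_op.rep_eq one_fock_op.rep_eq fock_basis_def
    by (metis lookup_single_eq lookup_zero zero_neq_one)
  then show "(0 :: fock_op) \<noteq> 1" by metis
next
  fix S T :: fock_op and c :: real
  show "S * (T + U) = S * T + S * U" for U
    by transfer (simp add: fun_eq_iff fock_pair.linear_add)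
  show "S * c *\<^sub>R T = c *\<^sub>R (S * T)"
    by transfer (simp add: fun_eq_iff fock_pair.linear_scale)
qed (transfer; simp add: fun_eq_iff algebra_simps fock.scale_right_distrib; fail)+

end

text \<open>The linear operator with prescribed values on the basis.\<close>

lift_definition linear_extension :: "(maya \<Rightarrow> fock) \<Rightarrow> fock_op"
  is "\<lambda>b v. \<Sum>S\<in>Poly_Mapping.keys v. fock_scale (Poly_Mapping.lookup v S) (b S)"
proof -
  fix b :: "maya \<Rightarrow> fock"
  define L where "L v = (\<Sum>S\<in>Poly_Mapping.keys v. fock_scale (Poly_Mapping.lookup v S) (b S))" for v :: fock
  have L: "L v = (\<Sum>S\<in>K. fock_scale (Poly_Mapping.lookup v S) (b S))"
    if "finite K" "Poly_Mapping.keys v \<subseteq> K" for v K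
    unfolding L_def using that by (intro sum.mono_neutral_left) (auto simp: in_keys_iff)
  have add: "L (u + v) = L u + L v" for u v
  proof -
    let ?K = "Poly_Mapping.keys u \<union> Poly_Mapping.keys v"
    have "Poly_Mapping.keys (u + v) \<subseteq> ?K" by (rule Poly_Mapping.keys_add)
    then show ?thesis
      by (simp add: L [of ?K] lookup_add fock.scale_left_distrib sum.distrib)
  qed
  have scale: "L (fock_scale c v) = fock_scale c (L v)" for c v
  proof -
    have "Poly_Mapping.keys (fock_scale c v) \<subseteq> Poly_Mapping.keys v"
      by (auto simp: in_keys_iff fock_scale.rep_eq)
    then show ?thesis
      by (simp add: L [of "Poly_Mapping.keys v"] fock_scale.rep_eq fock.scale_sum_right)
  qed
  have "Vector_Spaces.linear fock_scale fock_scale L"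
    by unfold_locales (auto simp: add scale)
  then show "Vector_Spaces.linear fock_scale fock_scale
      (\<lambda>v. \<Sum>S\<in>Poly_Mapping.keys v. fock_scale (Poly_Mapping.lookup v S) (b S))"
    unfolding L_def .
qed

lemma app_linear_extension [simp]: "app (linear_extension b) (fock_basis S) = b S"
  by (simp add: linear_extension.rep_eq fock_basis_def)

definition wedge_sign :: "int \<Rightarrow> maya \<Rightarrow> complex"
  where "wedge_sign j S = (- 1) ^ card {s \<in> occupied S. j < s}"

definition psi :: "int \<Rightarrow> fock_op"
  where "psi j = linear_extension (\<lambda>S.
    if j \<in> occupied S then 0 else fock_scale (wedge_sign j S) (fock_basis (maya_insert j S)))"

definition psi_star :: "int \<Rightarrow> fock_op"
  where "psi_star j = linear_extension (\<lambda>S.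
    if j \<in> occupied S then fock_scale (wedge_sign j S) (fock_basis (maya_remove j S)) else 0)"

definition normal_ordered :: "int \<Rightarrow> int \<Rightarrow> fock_op"
  where "normal_ordered i j = (if 0 < i then psi i * psi_star j else - (psi_star j * psi i))"

section \<open>Deformed currents\<close>

definition elem_sym :: "nat \<Rightarrow> (int \<Rightarrow> complex) \<Rightarrow> int set \<Rightarrow> complex"
  where "elem_sym r x I = (\<Sum>X | X \<subseteq> I \<and> card X = r. \<Prod>i\<in>X. x i)"

definition complete_sym :: "nat \<Rightarrow> (int \<Rightarrow> complex) \<Rightarrow> int set \<Rightarrow> complex"
  where "complete_sym s x I = (\<Sum>X | set_mset X \<subseteq> I \<and> size X = s. \<Prod>i\<in>#X. x i)"

text \<open>The bound on \<open>r\<close> only discards vanishing terms: \<open>e\<^sub>r\<close> has \<open>j - i - 1\<close> arguments.\<close>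

definition current_coeff ::
    "(int \<Rightarrow> complex) \<Rightarrow> (int \<Rightarrow> complex) \<Rightarrow> nat \<Rightarrow> int \<Rightarrow> int \<Rightarrow> complex"
  where "current_coeff \<alpha> \<beta> k i j =
    (if j < i then 0
     else if j = i then \<beta> i ^ k
     else (1 - \<alpha> j * \<beta> j) *
       (\<Sum>(r, s) | int r \<le> j - i - 1 \<and> int r - int s = j - i - int k.
          elem_sym r (\<lambda>l. - \<alpha> l) {i+1..j-1} * complete_sym s \<beta> {i..j}))"

text \<open>
  The sum over \<open>i, j\<close> is infinite, but on every basis vector only finitely many terms do not
  vanish; see \<open>finite_current_terms\<close>.
\<close>

definition current :: "(int \<Rightarrow> complex) \<Rightarrow> (int \<Rightarrow> complex) \<Rightarrow> nat \<Rightarrow> fock_op"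
  where "current \<alpha> \<beta> k = linear_extension (\<lambda>S. Sum_any (\<lambda>(i, j).
    fock_scale (current_coeff \<alpha> \<beta> k i j) (app (normal_ordered i j) (fock_basis S))))"

lemma maya_bounds:
  obtains m n where "m \<le> 0" "0 \<le> n" "\<And>i. i \<notin> occupied S \<Longrightarrow> m \<le> i" "\<And>i. i \<in> occupied S \<Longrightarrow> i \<le> n"
proof -
  have fin: "finite {i \<in> occupied S. 0 < i}" "finite {i. i \<le> 0 \<and> i \<notin> occupied S}"
    using occupied [of S] by auto
  define m where "m = Min (insert 0 {i. i \<le> 0 \<and> i \<notin> occupied S})"
  define n where "n = Max (insert 0 {i \<in> occupied S. 0 < i})"
  have m0: "m \<le> 0" unfolding m_def using fin by (intro Min_le) auto
  have n0: "0 \<le> n" unfolding n_def using fin by (intro Max_ge) auto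
  have "m \<le> i" if "i \<notin> occupied S" for i
  proof (cases "i \<le> 0")
    case True
    then show ?thesis unfolding m_def using fin that by (intro Min_le) auto
  qed (use m0 in auto)
  moreover have "i \<le> n" if "i \<in> occupied S" for i
  proof (cases "0 < i")
    case True
    then show ?thesis unfolding n_def using fin that by (intro Max_ge) auto
  qed (use n0 in auto)
  ultimately show ?thesis using that m0 n0 by blast
qed

lemma app_scale: "app T (fock_scale c v) = fock_scale c (app T v)"
  using fock_pair.linear_scale [OF app_linear] .

lemma app_0 [simp]: "app T 0 = 0"
  using fock_pair.linear_0 [OF app_linear] .

lemma finite_current_terms:
  "finite {(i, j). fock_scale (current_coeff \<alpha> \<beta> k i j) (app (normal_ordered i j) (fock_basis S)) \<noteq> 0}"
proof -
  obtain m n where mn: "m \<le> 0" "0 \<le> n" "\<And>i. i \<notin> occupied S \<Longrightarrow> m \<le> i" "\<And>i. i \<in> occupied S \<Longrightarrow> i \<le> n"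
    using maya_bounds [of S] by blast
  have "m \<le> i \<and> i \<le> n \<and> m \<le> j \<and> j \<le> n"
    if "fock_scale (current_coeff \<alpha> \<beta> k i j) (app (normal_ordered i j) (fock_basis S)) \<noteq> 0" for i j
  proof -
    from that have "current_coeff \<alpha> \<beta> k i j \<noteq> 0" and nz: "app (normal_ordered i j) (fock_basis S) \<noteq> 0"
      by auto
    then have ij: "i \<le> j" by (auto simp: current_coeff_def split: if_splits)
    show ?thesis
    proof (cases "0 < i")
      case True
      then have "app (psi i) (app (psi_star j) (fock_basis S)) \<noteq> 0"
        using nz by (simp add: normal_ordered_def times_fock_op.rep_eq)
      then have "j \<in> occupied S"
        by (auto simp: psi_star_def split: if_splits)
      with True ij mn show ?thesis by force
    next
      case False
      then have *: "app (psi_star j) (app (psi i) (fock_basis S)) \<noteq> 0"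
        using nz by (simp add: normal_ordered_def times_fock_op.rep_eq uminus_fock_op.rep_eq)
      then have i: "i \<notin> occupied S" by (auto simp: psi_def split: if_splits)
      with * have "j \<in> occupied (maya_insert i S)"
        by (auto simp: psi_def psi_star_def app_scale split: if_splits)
      then have "j = i \<or> j \<in> occupied S" by (simp add: maya_insert.rep_eq)
      with False i ij mn show ?thesis by force
    qed
  qed
  then have "{(i, j). fock_scale (current_coeff \<alpha> \<beta> k i j) (app (normal_ordered i j) (fock_basis S)) \<noteq> 0}
             \<subseteq> {m..n} \<times> {m..n}"
    by auto
  then show ?thesis by (rule finite_subset) auto
qed

definition H_plus :: "(int \<Rightarrow> complex) \<Rightarrow> (int \<Rightarrow> complex) \<Rightarrow> fock_op pser"
  where "H_plus \<alpha> \<beta> = plinear (current \<alpha> \<beta>)"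

section \<open>Double factorial Schur functions\<close>

text \<open>
  An element \<open>\<lambda>\<close> of \<open>\<int>\<^sup>n\<close> is a function of which only the values at \<open>1, \<dots>, n\<close> matter; the same
  convention is used for points \<open>z\<close> of \<open>\<complex>\<^sup>n\<close>. The vector \<open>|\<lambda>\<rangle>\<close> is
  \<open>\<psi>\<^bsub>\<lambda>\<^sub>1\<^esub> \<psi>\<^bsub>\<lambda>\<^sub>2-1\<^esub> \<cdots> \<psi>\<^bsub>\<lambda>\<^sub>n-n+1\<^esub> |\<emptyset>\<rangle>\<^bsub>-n\<^esub>\<close>.
\<close>

definition ket :: "nat \<Rightarrow> (nat \<Rightarrow> int) \<Rightarrow> fock"
  where "ket n l = foldr (\<lambda>i. app (psi (l i - int i + 1))) [1..<n+1]
    (fock_basis (maya_vacuum (- int n)))"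

definition double_factorial_schur ::
    "nat \<Rightarrow> (int \<Rightarrow> complex) \<Rightarrow> (int \<Rightarrow> complex) \<Rightarrow> (nat \<Rightarrow> int) \<Rightarrow> complex pser"
  where "double_factorial_schur n \<alpha> \<beta> l =
    pser_map (\<lambda>T. Poly_Mapping.lookup (app T (ket n l)) (maya_vacuum 0)) (pexp (H_plus \<alpha> \<beta>))"

definition xi :: "complex \<Rightarrow> complex pser"
  where "xi z = plinear (\<lambda>k. z ^ k)"

text \<open>\<open>Lambda_neg n \<beta>\<close> is \<open>\<Lambda>\<^bsub>-n\<^esub>(p|\<beta>)\<close>.\<close>

definition Lambda_neg :: "nat \<Rightarrow> (int \<Rightarrow> complex) \<Rightarrow> complex pser"
  where "Lambda_neg n \<beta> = - (\<Sum>j=1 - int n..0. plinear (\<lambda>k. \<beta> j ^ k))"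

section \<open>Expansions in shifted powers\<close>

text \<open>\<open>(2\<pi>i)\<^sup>-\<^sup>n \<oint> \<cdots> \<oint> g(z\<^sub>1, \<dots>, z\<^sub>n) dz\<^sub>n \<cdots> dz\<^sub>1\<close> over \<open>|z\<^sub>1| = \<cdots> = |z\<^sub>n| = r\<close>.\<close>

fun torus_integral :: "real \<Rightarrow> nat \<Rightarrow> ((nat \<Rightarrow> complex) \<Rightarrow> complex) \<Rightarrow> complex" where
  "torus_integral r 0 g = g (\<lambda>_. 0)"
| "torus_integral r (Suc n) g = torus_integral r n (\<lambda>z.
     contour_integral (circlepath 0 r) (\<lambda>w. g (z(Suc n := w))) / (2 * of_real pi * \<i>))"

text \<open>
  The coefficient of \<open>\<Prod>\<^sub>i (z\<^sub>i|b\<^sub>i)\<^bsup>l\<^sub>i\<^esup> / (z\<^sub>i;a\<^sub>i)\<^bsup>l\<^sub>i\<^esup>\<close> in \<open>F(z)\<close>, where \<open>a\<^sub>i\<close>, \<open>b\<^sub>i\<close> are sequences.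
\<close>

definition shifted_coeff ::
    "real \<Rightarrow> nat \<Rightarrow> (nat \<Rightarrow> int \<Rightarrow> complex) \<Rightarrow> (nat \<Rightarrow> int \<Rightarrow> complex) \<Rightarrow>
     ((nat \<Rightarrow> complex) \<Rightarrow> complex pser) \<Rightarrow> (nat \<Rightarrow> int) \<Rightarrow> complex pser"
  where "shifted_coeff r n a b F l = Abs_pser (\<lambda>M. torus_integral r n (\<lambda>z.
    pcoeff (F z) M * (\<Prod>i=1..n. shifted_dual (a i) (b i) (l i) (z i))))"

text \<open>
  The expansion \<open>\<Sum>\<^bsub>l\<in>\<int>\<^sup>n\<^esub> c\<^sub>l \<Prod>\<^sub>i (z\<^sub>i|b\<^sub>i)\<^bsup>l\<^sub>i\<^esup> / (z\<^sub>i;a\<^sub>i)\<^bsup>l\<^sub>i\<^esup> = F(z)\<close>. As everywhere with shifted powers, this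
  is a statement about the coefficients extracted by contour integrals; the series need not
  converge pointwise on the torus \<open>|z\<^sub>i| = r\<close>.
\<close>

definition has_shifted_expansion ::
    "real \<Rightarrow> nat \<Rightarrow> (nat \<Rightarrow> int \<Rightarrow> complex) \<Rightarrow> (nat \<Rightarrow> int \<Rightarrow> complex) \<Rightarrow>
     ((nat \<Rightarrow> int) \<Rightarrow> complex pser) \<Rightarrow> ((nat \<Rightarrow> complex) \<Rightarrow> complex pser) \<Rightarrow> bool"
  where "has_shifted_expansion r n a b c F \<longleftrightarrow> (\<forall>l. shifted_coeff r n a b F l = c l)"

end

theory Submission
  imports Defs
begin

text \<open>
  Both sides are formal power series in the indeterminates \<open>p\<^sub>k\<close>, and both are governed by exponentials
  of a linear series. The coefficients \<open>E\<^sub>M\<close> of \<open>exp (\<Sum>\<^sub>k p\<^sub>k c\<^sub>k / k)\<close> satisfy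
  \<open>|M| E\<^sub>M = \<Sum>\<^bsub>k\<in>M\<^esub> E\<^bsub>M-{k}\<^esub> c\<^sub>k / k\<close> (\<open>pexp_plinear_recursion\<close>), summed over the distinct \<open>k\<close> in \<open>M\<close>, even if the \<open>c\<^sub>k\<close> do not commute. On
  the fermionic side \<open>c\<^sub>k\<close> is the current \<open>J\<^sub>k\<close>; on the side of the generating function the factors
  \<open>e\<^sup>\<Lambda>\<close> and \<open>e\<^bsup>\<xi>(z\<^sub>i)\<^esup>\<close> combine to one exponential with
  \<open>c\<^sub>k = \<Sum>\<^sub>i z\<^sub>i\<^sup>k - \<Sum>\<^bsub>1-n\<le>j\<le>0\<^esub> \<beta>\<^sub>j\<^sup>k\<close>. It therefore suffices to compare how the two \<open>c\<^sub>k\<close> act, and to compare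
  the constant terms.

  Put \<open>j\<^sub>i = \<lambda>\<^sub>i - i + 1\<close>. After multiplication with the dual shifted power, the factor that depends
  on \<open>z\<^sub>i\<close> alone becomes a weight \<open>w\<^bsub>j\<^sub>i\<^esub>(z\<^sub>i)\<close> which depends on \<open>i\<close> only through \<open>j\<^sub>i\<close>
  (\<open>weight_eq_shifted_dual\<close>). So the coefficient of the generating function is a pairing of a
  polynomial \<open>P\<close> in \<open>z\<close> with \<open>\<Prod>\<^sub>i w\<^bsub>j\<^sub>i\<^esub>(z\<^sub>i)\<close>, to be compared with the vector
  \<open>\<psi>\<^bsub>j\<^sub>1\<^esub> \<cdots> \<psi>\<^bsub>j\<^sub>n\<^esub> |\<emptyset>\<rangle>\<^bsub>-n\<^esub>\<close>.

  Action of the currents. Since \<open>[J\<^sub>k, \<psi>\<^sub>j] = \<Sum>\<^sub>i A\<^sup>k\<^bsub>ij\<^esub> \<psi>\<^sub>i\<close> and \<open>J\<^sub>k\<close> multiplies \<open>|\<emptyset>\<rangle>\<^bsub>-n\<^esub>\<close> by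
  \<open>- \<Sum>\<^bsub>1-n\<le>j\<le>0\<^esub> \<beta>\<^sub>j\<^sup>k\<close>, the current replaces one index at a time by means of the matrix \<open>A\<^sup>k\<close>
  (\<open>current_fermion_state\<close>). On the other side, \<open>z\<^sup>k w\<^sub>j(z)\<close> and \<open>\<Sum>\<^bsub>i\<ge>1-n\<^esub> A\<^sup>k\<^bsub>ij\<^esub> w\<^sub>i(z)\<close> have the same
  integral against every polynomial (\<open>moment_shift\<close>): the explicit coefficients and the weights obey
  the same recurrence in \<open>j\<close>, and the weights with \<open>i \<le> -n\<close> are holomorphic inside the circle.

  Constant terms. Here \<open>\<langle>\<emptyset>| \<psi>\<^bsub>j\<^sub>1\<^esub> \<cdots> \<psi>\<^bsub>j\<^sub>n\<^esub> |\<emptyset>\<rangle>\<^bsub>-n\<^esub>\<close> has to agree with the pairing of a multiple of the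
  Vandermonde product (\<open>amplitude_eq_pairing\<close>). Both are alternating in \<open>j\<close>. If some \<open>j\<^sub>i\<close> lies
  outside \<open>{1-n..0}\<close>, both vanish. If \<open>1-n\<close> occurs, move it to the last place: \<open>\<psi>\<^bsub>1-n\<^esub>\<close> turns
  \<open>|\<emptyset>\<rangle>\<^bsub>-n\<^esub>\<close> into \<open>|\<emptyset>\<rangle>\<^bsub>1-n\<^esub>\<close>, while the integral over \<open>z\<^sub>n\<close> is the residue at the simple pole
  \<open>\<beta>\<^bsub>1-n\<^esub>\<close>, whose value cancels one pole of every other weight, so both sides reduce to \<open>n - 1\<close>. In the
  remaining case two indices coincide, and both sides vanish.
\<close>

section \<open>Exponentials of linear series\<close>

lemma pcoeff_plinear_singleton [simp]: "pcoeff (plinear c) {#k#} = c k /\<^sub>R real k"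
proof -
  have "pcoeff (plinear c) {#k#} =
      Sum_any (\<lambda>i. if {#k#} = {#Suc i#} then c (Suc i) /\<^sub>R real (Suc i) else 0)"
    by (simp only: plinear_def pser_sum.rep_eq pvar_scaled.rep_eq)
  also have "\<dots> = (\<Sum>i\<in>{k - 1}. if {#k#} = {#Suc i#} then c (Suc i) /\<^sub>R real (Suc i) else 0)"
    by (rule Sum_any.expand_superset) auto
  finally show ?thesis by (cases k) auto
qed

lemma pcoeff_plinear_eq_0: "size M \<noteq> 1 \<Longrightarrow> pcoeff (plinear c) M = 0"
proof -
  assume "size M \<noteq> 1"
  then have "M \<noteq> {#Suc i#}" for i by auto
  then show ?thesis by (simp add: plinear_def pser_sum.rep_eq pvar_scaled.rep_eq)
qed

lemma plinear_eqI:
  assumes "\<And>k. pcoeff F {#k#} = c k /\<^sub>R real k" and "\<And>M. size M \<noteq> 1 \<Longrightarrow> pcoeff F M = 0"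
  shows "F = plinear c"
proof (rule pser_eqI)
  fix M show "pcoeff F M = pcoeff (plinear c) M"
  proof (cases "size M = 1")
    case True
    then obtain k where "M = {#k#}" using size_1_singleton_mset by blast
    then show ?thesis using assms(1) by simp
  next
    case False
    then show ?thesis using assms(2) by (simp add: pcoeff_plinear_eq_0)
  qed
qed

lemma plinear_add: "plinear c + plinear d = plinear (\<lambda>k. c k + d k)"
  by (rule plinear_eqI) (simp_all add: plus_pser.rep_eq scaleR_add_right pcoeff_plinear_eq_0)

lemma plinear_zero: "plinear (\<lambda>_. 0) = 0"
  by (rule plinear_eqI [symmetric]) (simp_all add: zero_pser.rep_eq)

lemma plinear_uminus: "- plinear c = plinear (\<lambda>k. - c k)"
  by (rule plinear_eqI) (simp_all add: uminus_pser.rep_eq pcoeff_plinear_eq_0)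

lemma plinear_sum: "finite I \<Longrightarrow> (\<Sum>i\<in>I. plinear (c i)) = plinear (\<lambda>k. \<Sum>i\<in>I. c i k)"
  by (induction I rule: finite_induct) (simp_all add: plinear_zero plinear_add)

lemma pcoeff_mult_plinear:
  "pcoeff (G * plinear c) M = (\<Sum>k\<in>set_mset M. pcoeff G (M - {#k#}) * (c k /\<^sub>R real k))"
proof -
  have "pcoeff (G * plinear c) M = (\<Sum>(A, B) | A + B = M. pcoeff G A * pcoeff (plinear c) B)"
    by (simp add: times_pser.rep_eq)
  also have "\<dots> = (\<Sum>(A, B)\<in>(\<lambda>k. (M - {#k#}, {#k#})) ` set_mset M. pcoeff G A * pcoeff (plinear c) B)"
  proof (rule sum.mono_neutral_right)
    show "\<forall>P\<in>{(A, B). A + B = M} - (\<lambda>k. (M - {#k#}, {#k#})) ` set_mset M.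
            (case P of (A, B) \<Rightarrow> pcoeff G A * pcoeff (plinear c) B) = 0"
    proof (clarify, rule ccontr)
      fix A B assume *: "(A, B) \<notin> (\<lambda>k. (A + B - {#k#}, {#k#})) ` set_mset (A + B)"
        and "pcoeff G A * pcoeff (plinear c) B \<noteq> 0"
      then have "size B = 1" using pcoeff_plinear_eq_0 [of B c] by (metis mult_zero_right)
      then obtain k where "B = {#k#}" using size_1_singleton_mset by blast
      then show False using * by auto
    qed
  qed (auto simp: finite_splits)
  also have "\<dots> = (\<Sum>k\<in>set_mset M. pcoeff G (M - {#k#}) * (c k /\<^sub>R real k))"
    by (subst sum.reindex) (auto simp: inj_on_def)
  finally show ?thesis .
qed

lemma pcoeff_plinear_power_eq_0: "size M \<noteq> N \<Longrightarrow> pcoeff (plinear c ^ N) M = 0"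
proof (induction N arbitrary: M)
  case 0 then show ?case by (auto simp: one_pser.rep_eq)
next
  case (Suc N)
  have "pcoeff (plinear c ^ N) (M - {#k#}) = 0" if "k \<in># M" for k
    using Suc that by (intro Suc.IH) (auto simp: size_Diff_singleton dest: multi_member_split)
  then show ?case by (simp only: power_Suc2 pcoeff_mult_plinear) simp
qed

lemma pcoeff_pexp_plinear:
  "pcoeff (pexp (plinear c)) M = pcoeff (plinear c ^ size M) M /\<^sub>R fact (size M)"
proof -
  have "pcoeff (pexp (plinear c)) M = Sum_any (\<lambda>N. pcoeff (plinear c ^ N) M /\<^sub>R fact N)"
    by (simp add: pexp_def pser_sum.rep_eq pser_map.rep_eq)
  also have "\<dots> = (\<Sum>N\<in>{size M}. pcoeff (plinear c ^ N) M /\<^sub>R fact N)"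
  proof (rule Sum_any.expand_superset)
    show "{N. pcoeff (plinear c ^ N) M /\<^sub>R fact N \<noteq> 0} \<subseteq> {size M}"
      using pcoeff_plinear_power_eq_0 [where M = M and c = c] by (force intro: ccontr)
  qed simp
  finally show ?thesis by simp
qed

text \<open>
  The Euler derivation \<open>\<Sum>\<^sub>k p\<^sub>k \<partial>/\<partial>p\<^sub>k\<close>.
\<close>

lift_definition pdegree :: "'a::real_algebra_1 pser \<Rightarrow> 'a pser" is "\<lambda>f M. real (size M) *\<^sub>R f M" .

lemma pdegree_mult: "pdegree (F * G) = pdegree F * G + F * pdegree G"
proof (rule pser_eqI)
  fix M
  show "pcoeff (pdegree (F * G)) M = pcoeff (pdegree F * G + F * pdegree G) M"
    unfolding pdegree.rep_eq plus_pser.rep_eq times_pser.rep_eq scaleR_sum_right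
      sum.distrib [symmetric]
    by (rule sum.cong) (auto simp: scaleR_left_distrib)
qed

lemma pcoeff_pexp_plinear_empty: "pcoeff (pexp (plinear c)) {#} = 1"
  by (simp add: pcoeff_pexp_plinear one_pser.rep_eq)

text \<open>
  The powers of a linear series \<open>L\<close> are homogeneous, so the part
  of degree \<open>N\<close> of \<open>exp L\<close> is \<open>L\<^sup>N / N!\<close>, and \<open>N\<close> times it is \<open>(L\<^bsup>N-1\<^esup> / (N-1)!) L\<close>.
\<close>

lemma pdegree_pexp_plinear: "pdegree (pexp (plinear c)) = pexp (plinear c) * plinear c"
proof (rule pser_eqI)
  fix M :: "nat multiset"
  show "pcoeff (pdegree (pexp (plinear c))) M = pcoeff (pexp (plinear c) * plinear c) M"
  proof (cases "size M")
    case 0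
    then show ?thesis by (simp add: pdegree.rep_eq pcoeff_mult_plinear)
  next
    case (Suc N)
    have "pcoeff (plinear c ^ Suc N) M /\<^sub>R fact N =
        (\<Sum>k\<in>set_mset M. (pcoeff (plinear c ^ N) (M - {#k#}) /\<^sub>R fact N) * (c k /\<^sub>R real k))"
      by (simp only: power_Suc2 pcoeff_mult_plinear scaleR_sum_right) (simp add: mult.commute)
    also have "\<dots> = pcoeff (pexp (plinear c) * plinear c) M"
      unfolding pcoeff_mult_plinear pcoeff_pexp_plinear
      using Suc by (intro sum.cong) (auto simp: size_Diff_singleton)
    finally show ?thesis using Suc
      by (simp add: pdegree.rep_eq pcoeff_pexp_plinear field_simps del: power_Suc of_nat_Suc)
  qed
qed

text \<open>
  The equation \<open>D X = X L\<close> expresses each coefficient by coefficients of smaller degree, so it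
  determines \<open>X\<close> from its constant term.
\<close>

lemma pexp_plinear_unique:
  assumes X: "pdegree X = X * plinear c" "pcoeff X {#} = 1"
  shows "X = pexp (plinear c)"
proof (rule pser_eqI)
  fix M show "pcoeff X M = pcoeff (pexp (plinear c)) M"
  proof (induction "size M" arbitrary: M)
    case 0 then show ?case by (simp add: X pcoeff_pexp_plinear_empty)
  next
    case (Suc N)
    have "real (size M) *\<^sub>R pcoeff X M = pcoeff (X * plinear c) M"
      using X(1) by (metis pdegree.rep_eq)
    also have "\<dots> = pcoeff (pexp (plinear c) * plinear c) M"
      unfolding pcoeff_mult_plinear
      using Suc by (intro sum.cong) (auto simp: size_Diff_singleton)
    also have "\<dots> = real (size M) *\<^sub>R pcoeff (pexp (plinear c)) M"
      by (metis pdegree_pexp_plinear pdegree.rep_eq)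
    finally show ?case using Suc(2) by (auto simp flip: size_eq_0_iff_empty)
  qed
qed

lemma pcoeff_mult_empty: "pcoeff (F * G) {#} = pcoeff F {#} * pcoeff G {#}"
proof -
  have "{(A, B). A + B = ({#} :: nat multiset)} = {({#}, {#})}" by auto
  then show ?thesis by (simp add: times_pser.rep_eq)
qed

text \<open>
  By the product rule, the left side solves the equation that characterizes the right side.
\<close>

lemma pexp_plinear_add:
  fixes c d :: "nat \<Rightarrow> 'a::{real_algebra_1, comm_ring_1}"
  shows "pexp (plinear c) * pexp (plinear d) = pexp (plinear (\<lambda>k. c k + d k))"
  by (rule pexp_plinear_unique)
     (simp_all add: pdegree_mult pdegree_pexp_plinear pcoeff_mult_empty pcoeff_pexp_plinear_empty
       algebra_simps flip: plinear_add)

lemma pexp_plinear_sum: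
  fixes c :: "'b \<Rightarrow> nat \<Rightarrow> 'a::{real_algebra_1, comm_ring_1}"
  assumes "finite I"
  shows "(\<Prod>i\<in>I. pexp (plinear (c i))) = pexp (plinear (\<lambda>k. \<Sum>i\<in>I. c i k))"
proof -
  have "pexp (plinear (\<lambda>_. 0)) = (1 :: 'a pser)"
    by (rule pexp_plinear_unique [symmetric])
       (auto simp: plinear_zero one_pser.rep_eq pdegree.rep_eq zero_pser.rep_eq intro: pser_eqI)
  with assms show ?thesis
    by (induction I rule: finite_induct) (simp_all add: pexp_plinear_add)
qed

text \<open>
  The coefficient recursion by which the two sides are compared; it is the Euler equation
  \<open>D E = E L\<close> for \<open>E = exp L\<close>, read off at one monomial.
\<close>

lemma pexp_plinear_recursion:
  "real (size M) *\<^sub>R pcoeff (pexp (plinear c)) M =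
     (\<Sum>k\<in>set_mset M. pcoeff (pexp (plinear c)) (M - {#k#}) * (c k /\<^sub>R real k))"
  by (metis pdegree_pexp_plinear pdegree.rep_eq pcoeff_mult_plinear)

lemma pcoeff_mult_pconst: "pcoeff (F * pconst a) M = pcoeff F M * a"
proof -
  have "(\<Sum>(A, B) | A + B = M. pcoeff F A * pcoeff (pconst a) B) =
        (\<Sum>(A, B)\<in>{(M, {#})}. pcoeff F A * pcoeff (pconst a) B)"
    by (rule sum.mono_neutral_right) (auto simp: finite_splits pconst.rep_eq split: if_splits)
  then show ?thesis by (simp add: times_pser.rep_eq pconst.rep_eq)
qed

lemma pconst_mult: "pconst a * pconst b = pconst (a * b)"
  by (rule pser_eqI) (simp add: pcoeff_mult_pconst pconst.rep_eq)

lemma pconst_prod: "finite I \<Longrightarrow> (\<Prod>i\<in>I. pconst (f i)) = pconst (\<Prod>i\<in>I. f i)"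
proof (induction I rule: finite_induct)
  case empty show ?case by (rule pser_eqI) (simp add: one_pser.rep_eq pconst.rep_eq)
qed (simp add: pconst_mult)

section \<open>The coefficients of the currents\<close>

lemma elem_sym_0: "finite I \<Longrightarrow> elem_sym 0 x I = 1"
proof -
  assume "finite I"
  then have "{X. X \<subseteq> I \<and> card X = 0} = {{}}" by (auto dest: finite_subset)
  then show ?thesis by (simp add: elem_sym_def)
qed

lemma elem_sym_eq_0: "finite I \<Longrightarrow> card I < r \<Longrightarrow> elem_sym r x I = 0"
proof -
  assume "finite I" "card I < r"
  then have "{X. X \<subseteq> I \<and> card X = r} = {}" using card_mono leD by blast
  then show ?thesis unfolding elem_sym_def by (simp only: sum.empty)
qed

text \<open>Split by whether a subset contains the new index.\<close>

lemma elem_sym_insert: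
  assumes "finite I" "a \<notin> I"
  shows "elem_sym (Suc r) x (insert a I) = elem_sym (Suc r) x I + x a * elem_sym r x I"
proof -
  let ?S = "\<lambda>r I. {X. X \<subseteq> I \<and> card X = r}"
  have fin: "finite (?S r I)" for r using assms by simp
  have *: "?S (Suc r) (insert a I) = ?S (Suc r) I \<union> insert a ` ?S r I"
  proof (intro equalityI subsetI)
    fix X assume X: "X \<in> ?S (Suc r) (insert a I)"
    show "X \<in> ?S (Suc r) I \<union> insert a ` ?S r I"
    proof (cases "a \<in> X")
      case True
      then have "X = insert a (X - {a})" "X - {a} \<in> ?S r I" using X by auto
      then show ?thesis by blast
    qed (use X in auto)
  next
    fix X assume "X \<in> ?S (Suc r) I \<union> insert a ` ?S r I"
    then consider "X \<in> ?S (Suc r) I" | Y where "X = insert a Y" "Y \<in> ?S r I" by auto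
    then show "X \<in> ?S (Suc r) (insert a I)"
    proof cases
      case 2
      have "finite Y" "a \<notin> Y" using 2 assms by (auto dest: finite_subset)
      then show ?thesis using 2 by auto
    qed auto
  qed
  have "elem_sym (Suc r) x (insert a I) =
      (\<Sum>X\<in>?S (Suc r) I. \<Prod>i\<in>X. x i) + (\<Sum>X\<in>insert a ` ?S r I. \<Prod>i\<in>X. x i)"
    unfolding elem_sym_def * using assms fin by (intro sum.union_disjoint) auto
  also have "(\<Sum>X\<in>insert a ` ?S r I. \<Prod>i\<in>X. x i) = (\<Sum>X\<in>?S r I. \<Prod>i\<in>insert a X. x i)"
    using assms by (subst sum.reindex) (auto simp: inj_on_def insert_ident dest: subsetD)
  also have "\<dots> = (\<Sum>X\<in>?S r I. x a * (\<Prod>i\<in>X. x i))"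
    using assms by (intro sum.cong refl prod.insert) (auto dest: finite_subset)
  finally show ?thesis by (simp add: elem_sym_def sum_distrib_left)
qed

lemma finite_multisets_of_size: "finite I \<Longrightarrow> finite {X. set_mset X \<subseteq> I \<and> size X = s}"
proof -
  assume "finite I"
  then have "finite {xs. set xs \<subseteq> I \<and> length xs = s}" by (rule finite_lists_length_eq)
  moreover have "{X. set_mset X \<subseteq> I \<and> size X = s} \<subseteq> mset ` {xs. set xs \<subseteq> I \<and> length xs = s}"
  proof
    fix X assume *: "X \<in> {X. set_mset X \<subseteq> I \<and> size X = s}"
    obtain xs where "mset xs = X" using ex_mset by blast
    with * show "X \<in> mset ` {xs. set xs \<subseteq> I \<and> length xs = s}" by force
  qed
  ultimately show ?thesis by (meson finite_surj)
qed

lemma complete_sym_0: "complete_sym 0 x I = 1"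
proof -
  have "{X. set_mset X \<subseteq> I \<and> size X = 0} = {{#}}" by auto
  then show ?thesis by (simp add: complete_sym_def)
qed

text \<open>
  Split by whether the new index occurs at all; if it does, remove one copy. The index stays
  available, hence the \<open>insert\<close> in the last term.
\<close>

lemma complete_sym_insert:
  assumes "finite I" "a \<notin> I"
  shows "complete_sym (Suc s) x (insert a I) = complete_sym (Suc s) x I + x a * complete_sym s x (insert a I)"
proof -
  let ?S = "\<lambda>s I. {X. set_mset X \<subseteq> I \<and> size X = s}"
  have fin: "finite (?S s I)" "finite (?S s (insert a I))" for s
    using assms by (auto intro!: finite_multisets_of_size)
  have *: "?S (Suc s) (insert a I) = ?S (Suc s) I \<union> add_mset a ` ?S s (insert a I)"
  proof (intro equalityI subsetI)
    fix X assume X: "X \<in> ?S (Suc s) (insert a I)"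
    show "X \<in> ?S (Suc s) I \<union> add_mset a ` ?S s (insert a I)"
    proof (cases "a \<in># X")
      case True
      then obtain Y where "X = add_mset a Y" by (metis multi_member_split)
      then show ?thesis using X by auto
    qed (use X in auto)
  qed auto
  have "complete_sym (Suc s) x (insert a I) =
      (\<Sum>X\<in>?S (Suc s) I. \<Prod>i\<in>#X. x i) + (\<Sum>X\<in>add_mset a ` ?S s (insert a I). \<Prod>i\<in>#X. x i)"
    unfolding complete_sym_def * using assms fin by (intro sum.union_disjoint) auto
  also have "(\<Sum>X\<in>add_mset a ` ?S s (insert a I). \<Prod>i\<in>#X. x i) =
      (\<Sum>X\<in>?S s (insert a I). x a * (\<Prod>i\<in>#X. x i))"
    by (subst sum.reindex) (auto simp: inj_on_def)
  finally show ?thesis by (simp add: complete_sym_def sum_distrib_left)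
qed

lemma complete_sym_singleton: "complete_sym s x {a} = x a ^ s"
proof -
  have "{X. set_mset X \<subseteq> {a} \<and> size X = s} = {replicate_mset s a}"
    by (auto simp: set_mset_subset_singletonD split: if_splits)
  then show ?thesis by (simp add: complete_sym_def)
qed

text \<open>
  With integer degrees the sum over \<open>r - s = const\<close> in the current coefficients becomes a sum
  over \<open>r\<close> alone.
\<close>

definition complete_sym_int :: "int \<Rightarrow> (int \<Rightarrow> complex) \<Rightarrow> int set \<Rightarrow> complex"
  where "complete_sym_int s x I = (if s < 0 then 0 else complete_sym (nat s) x I)"

lemma complete_sym_int_insert:
  assumes "finite I" "a \<notin> I"
  shows "complete_sym_int s x (insert a I) =
    complete_sym_int s x I + x a * complete_sym_int (s - 1) x (insert a I)"
proof (cases "s \<le> 0")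
  case True
  then show ?thesis by (auto simp: complete_sym_int_def complete_sym_0)
next
  case False
  then have "nat s = Suc (nat (s - 1))" by linarith
  then show ?thesis using False complete_sym_insert [OF assms, of "nat (s - 1)"]
    by (simp add: complete_sym_int_def)
qed

text \<open>
  The upper limit is arbitrary, so that sums for different \<open>i\<close>, \<open>j\<close> and \<open>k\<close> can be given a common
  range.
\<close>

lemma current_coeff_off_diagonal:
  assumes "i < j" "j - i - 1 \<le> int R"
  shows "current_coeff \<alpha> \<beta> k i j = (1 - \<alpha> j * \<beta> j) *
    (\<Sum>r\<le>R. elem_sym r (\<lambda>l. - \<alpha> l) {i+1..j-1} * complete_sym_int (int r - (j - i) + int k) \<beta> {i..j})"
proof -
  let ?f = "\<lambda>r s. elem_sym r (\<lambda>l. - \<alpha> l) {i+1..j-1} * complete_sym s \<beta> {i..j}"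
  let ?h = "\<lambda>r. elem_sym r (\<lambda>l. - \<alpha> l) {i+1..j-1} * complete_sym_int (int r - (j - i) + int k) \<beta> {i..j}"
  let ?D = "{r. int r \<le> j - i - 1 \<and> 0 \<le> int r - (j - i) + int k}"
  have "(\<Sum>(r, s) | int r \<le> j - i - 1 \<and> int r - int s = j - i - int k. ?f r s) = (\<Sum>r\<in>?D. ?h r)"
    by (rule sum.reindex_bij_witness
          [where i = "\<lambda>r. (r, nat (int r - (j - i) + int k))" and j = fst])
       (auto simp: complete_sym_int_def algebra_simps)
  also have "\<dots> = (\<Sum>r\<le>R. ?h r)"
  proof (rule sum.mono_neutral_left)
    show "\<forall>r\<in>{..R} - ?D. ?h r = 0"
      using assms by (auto simp: complete_sym_int_def intro!: elem_sym_eq_0)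
  qed (use assms in auto)
  finally show ?thesis using assms by (simp add: current_coeff_def)
qed

lemma current_coeff_below: "j < i \<Longrightarrow> current_coeff \<alpha> \<beta> k i j = 0"
  by (simp add: current_coeff_def)

lemma current_coeff_diagonal: "current_coeff \<alpha> \<beta> k i i = \<beta> i ^ k"
  by (simp add: current_coeff_def)

lemma current_coeff_0: "current_coeff \<alpha> \<beta> 0 i j = (if i = j then 1 else 0)"
proof -
  have "{(r, s). int r \<le> j - i - 1 \<and> int r - int s = j - i - int 0} = {}" by auto
  then show ?thesis unfolding current_coeff_def by (simp only: sum.empty) simp
qed

text \<open>
  This is the coefficient form of
  \<open>(z - \<beta>\<^bsub>x+1\<^esub>) D\<^bsub>x+1\<^esub>(z) = (1 - z \<alpha>\<^sub>x) D\<^sub>x(z)\<close> with \<open>D\<^sub>x(z) = (z;\<alpha>)\<^bsup>x-1\<^esup> / (z|\<beta>)\<^sup>x\<close>, since \<open>A\<^sup>k\<^bsub>ix\<^esub>\<close> is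
  \<open>1 - \<alpha>\<^sub>x \<beta>\<^sub>x\<close> times the integral of \<open>z\<^sup>k D\<^sub>x(z)\<close> against a function that does not depend on \<open>x\<close>. For the explicit formula it results from removing
  \<open>\<beta>\<^bsub>x+1\<^esub>\<close> from the complete and \<open>\<alpha>\<^sub>x\<close> from the elementary symmetric functions.
\<close>

lemma current_coeff_recurrence:
  "(1 - \<alpha> x * \<beta> x) * (current_coeff \<alpha> \<beta> (Suc k) i (x+1) - \<beta> (x+1) * current_coeff \<alpha> \<beta> k i (x+1)) =
   (1 - \<alpha> (x+1) * \<beta> (x+1)) * (current_coeff \<alpha> \<beta> k i x - \<alpha> x * current_coeff \<alpha> \<beta> (Suc k) i x)"
proof -
  consider "x + 1 < i" | "i = x + 1" | "i = x" | "i < x" by linarith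
  then show ?thesis
  proof cases
    case 3
    have J: "{x..x+1} = insert (x+1) {x}" by auto
    have h: "complete_sym_int (int k) \<beta> {x..x+1} =
        \<beta> x ^ k + \<beta> (x+1) * complete_sym_int (int k - 1) \<beta> {x..x+1}"
      unfolding J by (subst complete_sym_int_insert)
         (auto simp: complete_sym_int_def complete_sym_singleton)
    have A: "current_coeff \<alpha> \<beta> l x (x+1) = (1 - \<alpha> (x+1) * \<beta> (x+1)) * complete_sym_int (int l - 1) \<beta> {x..x+1}" for l
      by (subst current_coeff_off_diagonal [where R = 0]) (simp_all add: elem_sym_0)
    have "int (Suc k) - 1 = int k" by simp
    then show ?thesis unfolding 3 A current_coeff_diagonal
      by (simp only: h) (simp add: algebra_simps)
  next
    case 4
    define I where "I = {i+1..x-1}"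
    define J where "J = {i..x}"
    define d where "d = x - i"
    define R where "R = nat d"
    let ?e = "\<lambda>r. elem_sym r (\<lambda>l. - \<alpha> l)"
    let ?h = "\<lambda>s. complete_sym_int s \<beta>"
    have I': "{i+1..x+1-1} = insert x I" and J': "{i..x+1} = insert (x+1) J"
      using 4 by (auto simp: I_def J_def)
    have x: "x \<notin> I" "x + 1 \<notin> J" "finite I" "finite J" by (auto simp: I_def J_def)
    have cardI: "card I \<le> R" using 4 by (simp add: I_def R_def d_def)
    have A: "current_coeff \<alpha> \<beta> k i x = (1 - \<alpha> x * \<beta> x) * (\<Sum>r\<le>Suc R. ?e r I * ?h (int r - d + int k) J)"
      "current_coeff \<alpha> \<beta> (Suc k) i x = (1 - \<alpha> x * \<beta> x) * (\<Sum>r\<le>R. ?e r I * ?h (int (Suc r) - d + int k) J)" for k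
      using 4 current_coeff_off_diagonal [of i x "Suc R" \<alpha> \<beta> k]
        current_coeff_off_diagonal [of i x R \<alpha> \<beta> "Suc k"]
      by (simp_all add: I_def J_def d_def R_def algebra_simps)
    have B: "current_coeff \<alpha> \<beta> k i (x+1) = (1 - \<alpha> (x+1) * \<beta> (x+1)) *
        (\<Sum>r\<le>Suc R. ?e r (insert x I) * ?h (int r - d - 1 + int k) (insert (x+1) J))" for k
      using 4 current_coeff_off_diagonal [of i "x+1" "Suc R" \<alpha> \<beta> k]
      unfolding I' J' by (simp add: d_def R_def algebra_simps)
    \<comment> \<open>remove \<open>\<beta>\<^bsub>x+1\<^esub>\<close> from \<open>h\<close>, then \<open>\<alpha>\<^sub>x\<close> from \<open>e\<close>\<close>
    have "(\<Sum>r\<le>Suc R. ?e r (insert x I) * ?h (int r - d - 1 + int (Suc k)) (insert (x+1) J)) -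
          \<beta> (x+1) * (\<Sum>r\<le>Suc R. ?e r (insert x I) * ?h (int r - d - 1 + int k) (insert (x+1) J)) =
        (\<Sum>r\<le>Suc R. ?e r (insert x I) * ?h (int r - d + int k) J)"
      by (simp only: complete_sym_int_insert [OF x(4,2), of "_ - 1 + int (Suc _)"]
           sum_distrib_left flip: sum_subtractf) (simp add: algebra_simps)
    also have "\<dots> = ?h (int k - d) J +
        (\<Sum>r\<le>R. (?e (Suc r) I - \<alpha> x * ?e r I) * ?h (int (Suc r) - d + int k) J)"
      unfolding sum.atMost_Suc_shift elem_sym_insert [OF x(3,1)] by (simp add: elem_sym_0 x algebra_simps)
    also have "\<dots> = (\<Sum>r\<le>Suc R. ?e r I * ?h (int r - d + int k) J) -
        \<alpha> x * (\<Sum>r\<le>R. ?e r I * ?h (int (Suc r) - d + int k) J)"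
      unfolding sum.atMost_Suc_shift
      by (simp add: elem_sym_0 x sum_distrib_left algebra_simps sum_subtractf)
    finally have *: "(\<Sum>r\<le>Suc R. ?e r (insert x I) * ?h (int r - d - 1 + int (Suc k)) (insert (x+1) J)) -
          \<beta> (x+1) * (\<Sum>r\<le>Suc R. ?e r (insert x I) * ?h (int r - d - 1 + int k) (insert (x+1) J)) =
        (\<Sum>r\<le>Suc R. ?e r I * ?h (int r - d + int k) J) -
        \<alpha> x * (\<Sum>r\<le>R. ?e r I * ?h (int (Suc r) - d + int k) J)" .
    have "current_coeff \<alpha> \<beta> (Suc k) i (x+1) - \<beta> (x+1) * current_coeff \<alpha> \<beta> k i (x+1) =
      (1 - \<alpha> (x+1) * \<beta> (x+1)) * ((\<Sum>r\<le>Suc R. ?e r I * ?h (int r - d + int k) J) -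
        \<alpha> x * (\<Sum>r\<le>R. ?e r I * ?h (int (Suc r) - d + int k) J))"
      unfolding B * [symmetric] by (simp only: right_diff_distrib mult.left_commute)
    moreover have "current_coeff \<alpha> \<beta> k i x - \<alpha> x * current_coeff \<alpha> \<beta> (Suc k) i x =
      (1 - \<alpha> x * \<beta> x) * ((\<Sum>r\<le>Suc R. ?e r I * ?h (int r - d + int k) J) -
        \<alpha> x * (\<Sum>r\<le>R. ?e r I * ?h (int (Suc r) - d + int k) J))"
      unfolding A(1) [of k] A(2) [of k] by (simp only: right_diff_distrib mult.left_commute)
    ultimately show ?thesis by (simp only: mult.left_commute)
  qed (simp_all add: current_coeff_below current_coeff_diagonal)
qed

section \<open>Torus integrals of separable functions\<close>

text \<open>
  The linear span of products of functions of one variable. On it, iterated integrals are linear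
  and their order is irrelevant, without a Fubini theorem.
\<close>

inductive separable :: "real \<Rightarrow> nat \<Rightarrow> ((nat \<Rightarrow> complex) \<Rightarrow> complex) \<Rightarrow> bool" for r n where
  product: "(\<And>a. continuous_on (sphere 0 r) (f a)) \<Longrightarrow> separable r n (\<lambda>z. \<Prod>a=1..n. f a (z a))"
| add: "separable r n F \<Longrightarrow> separable r n G \<Longrightarrow> separable r n (\<lambda>z. F z + G z)"
| scale: "separable r n F \<Longrightarrow> separable r n (\<lambda>z. c * F z)"

definition circle_mean :: "real \<Rightarrow> (complex \<Rightarrow> complex) \<Rightarrow> complex"
  where "circle_mean r f = contour_integral (circlepath 0 r) f / (2 * of_real pi * \<i>)"

lemma torus_integral_Suc:
  "torus_integral r (Suc n) F = torus_integral r n (\<lambda>z. circle_mean r (\<lambda>w. F (z(Suc n := w))))"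
  by (simp add: circle_mean_def)

context
  fixes r :: real
  assumes r: "0 < r"
begin

lemma circle_integrable: "continuous_on (sphere 0 r) f \<Longrightarrow> f contour_integrable_on circlepath 0 r"
  using r by (intro contour_integrable_continuous_circlepath) (simp add: path_image_circlepath_nonneg)

lemma circle_mean_cong:
  "(\<And>w. cmod w = r \<Longrightarrow> f w = g w) \<Longrightarrow> circle_mean r f = circle_mean r g"
  unfolding circle_mean_def
  using r by (intro arg_cong2 [where f = "(/)"] contour_integral_cong)
    (auto simp: path_image_circlepath_nonneg)

lemma circle_mean_add:
  "continuous_on (sphere 0 r) f \<Longrightarrow> continuous_on (sphere 0 r) g \<Longrightarrow>
   circle_mean r (\<lambda>w. f w + g w) = circle_mean r f + circle_mean r g"
  by (simp add: circle_mean_def contour_integral_add circle_integrable add_divide_distrib)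

lemma circle_mean_mult:
  "continuous_on (sphere 0 r) f \<Longrightarrow> circle_mean r (\<lambda>w. c * f w) = c * circle_mean r f"
  by (simp add: circle_mean_def contour_integral_lmul circle_integrable)

lemma circle_mean_holomorphic: "f holomorphic_on cball 0 r \<Longrightarrow> circle_mean r f = 0"
proof -
  assume "f holomorphic_on cball 0 r"
  then have "(f has_contour_integral 0) (circlepath 0 r)"
    by (rule Cauchy_theorem_convex_simple) (use r in auto)
  then show ?thesis by (simp add: circle_mean_def contour_integral_unique)
qed

lemma circle_mean_Cauchy:
  assumes "f holomorphic_on cball 0 r" "cmod b < r"
  shows "circle_mean r (\<lambda>w. f w / (w - b)) = f b"
proof -
  have "((\<lambda>w. f w / (w - b)) has_contour_integral 2 * of_real pi * \<i> * f b) (circlepath 0 r)"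
    by (rule Cauchy_integral_circlepath_simple) (use assms in auto)
  then show ?thesis by (simp add: circle_mean_def contour_integral_unique)
qed

lemma separable_slice:
  "separable r (Suc n) F \<Longrightarrow> continuous_on (sphere 0 r) (\<lambda>w. F (z(Suc n := w)))"
proof (induction rule: separable.induct)
  case (product f)
  have "(\<Prod>a=1..Suc n. f a ((z(Suc n := w)) a)) = (\<Prod>a=1..n. f a (z a)) * f (Suc n) w" for w
    by (simp add: prod.nat_ivl_Suc')
  then show ?case using product by (simp add: continuous_on_mult_left)
qed (auto intro!: continuous_intros)

lemma separable_circle_mean:
  "separable r (Suc n) F \<Longrightarrow> separable r n (\<lambda>z. circle_mean r (\<lambda>w. F (z(Suc n := w))))"
proof (induction rule: separable.induct)
  case (product f)
  have "circle_mean r (\<lambda>w. \<Prod>a=1..Suc n. f a ((z(Suc n := w)) a)) =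
        circle_mean r (f (Suc n)) * (\<Prod>a=1..n. f a (z a))" for z
  proof -
    have "circle_mean r (\<lambda>w. \<Prod>a=1..Suc n. f a ((z(Suc n := w)) a)) =
          circle_mean r (\<lambda>w. (\<Prod>a=1..n. f a (z a)) * f (Suc n) w)"
      by (simp add: prod.nat_ivl_Suc')
    then show ?thesis using product by (simp add: circle_mean_mult)
  qed
  then show ?case using separable.scale [OF separable.product] product by simp
next
  case (add F G)
  then show ?case by (simp only: circle_mean_add separable_slice separable.add)
next
  case (scale F c)
  then show ?case by (simp only: circle_mean_mult separable_slice separable.scale)
qed

lemma torus_integral_cong:
  "(\<And>z. (\<And>a. a \<in> {1..n} \<Longrightarrow> cmod (z a) = r) \<Longrightarrow> F z = G z) \<Longrightarrow> torus_integral r n F = torus_integral r n G"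
proof (induction n arbitrary: F G)
  case (Suc n)
  show ?case unfolding torus_integral_Suc
    by (rule Suc.IH, rule circle_mean_cong, rule Suc.prems) (auto simp: le_Suc_eq)
qed auto

lemma torus_integral_add:
  "separable r n F \<Longrightarrow> separable r n G \<Longrightarrow>
   torus_integral r n (\<lambda>z. F z + G z) = torus_integral r n F + torus_integral r n G"
proof (induction n arbitrary: F G)
  case (Suc n)
  then show ?case unfolding torus_integral_Suc
    by (simp only: circle_mean_add separable_slice separable_circle_mean)
qed auto

lemma torus_integral_mult:
  "separable r n F \<Longrightarrow> torus_integral r n (\<lambda>z. c * F z) = c * torus_integral r n F"
proof (induction n arbitrary: F)
  case (Suc n)
  then show ?case unfolding torus_integral_Suc
    by (simp only: circle_mean_mult separable_slice separable_circle_mean)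
qed auto

lemma torus_integral_product:
  assumes "\<And>a. continuous_on (sphere 0 r) (f a)"
  shows "torus_integral r n (\<lambda>z. \<Prod>a=1..n. f a (z a)) = (\<Prod>a=1..n. circle_mean r (f a))"
proof (induction n)
  case (Suc n)
  have "circle_mean r (\<lambda>w. \<Prod>a=1..Suc n. f a ((z(Suc n := w)) a)) =
        circle_mean r (f (Suc n)) * (\<Prod>a=1..n. f a (z a))" for z
  proof -
    have "circle_mean r (\<lambda>w. \<Prod>a=1..Suc n. f a ((z(Suc n := w)) a)) =
          circle_mean r (\<lambda>w. (\<Prod>a=1..n. f a (z a)) * f (Suc n) w)"
      by (simp add: prod.nat_ivl_Suc')
    then show ?thesis using assms by (simp add: circle_mean_mult)
  qed
  then show ?case unfolding torus_integral_Suc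
    using Suc assms torus_integral_mult [OF separable.product, of f n "circle_mean r (f (Suc n))"]
    by (simp add: prod.nat_ivl_Suc' mult.commute)
qed auto

end

inductive polynomial_fun :: "nat \<Rightarrow> ((nat \<Rightarrow> complex) \<Rightarrow> complex) \<Rightarrow> bool" for n where
  monomial: "polynomial_fun n (\<lambda>z. \<Prod>a=1..n. z a ^ e a)"
| add: "polynomial_fun n P \<Longrightarrow> polynomial_fun n Q \<Longrightarrow> polynomial_fun n (\<lambda>z. P z + Q z)"
| scale: "polynomial_fun n P \<Longrightarrow> polynomial_fun n (\<lambda>z. c * P z)"

lemma polynomial_fun_const: "polynomial_fun n (\<lambda>_. c)"
  using polynomial_fun.scale [OF polynomial_fun.monomial [of n "\<lambda>_. 0"], of c] by simp

lemma polynomial_fun_sum: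
  "finite I \<Longrightarrow> (\<And>i. i \<in> I \<Longrightarrow> polynomial_fun n (P i)) \<Longrightarrow> polynomial_fun n (\<lambda>z. \<Sum>i\<in>I. P i z)"
  by (induction I rule: finite_induct) (auto intro: polynomial_fun_const polynomial_fun.add)

lemma monomial_times_coordinate:
  fixes z :: "nat \<Rightarrow> complex"
  assumes "b \<in> {1..n}"
  shows "z b ^ k * (\<Prod>a=1..n. z a ^ e a) = (\<Prod>a=1..n. z a ^ (e(b := e b + k)) a)"
proof -
  have "(\<Prod>a=1..n. z a ^ (e(b := e b + k)) a) = (\<Prod>a=1..n. (if a = b then z b ^ k else 1) * z a ^ e a)"
    by (intro prod.cong) (auto simp: power_add)
  then show ?thesis using assms by (simp add: prod.distrib)
qed

lemma polynomial_fun_coordinate: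
  "polynomial_fun n P \<Longrightarrow> b \<in> {1..n} \<Longrightarrow> polynomial_fun n (\<lambda>z. z b ^ k * P z)"
proof (induction rule: polynomial_fun.induct)
  case (monomial e)
  then show ?case by (simp only: monomial_times_coordinate polynomial_fun.monomial)
next
  case (add P Q)
  then show ?case by (simp add: distrib_left polynomial_fun.add)
next
  case (scale P c)
  then show ?case using polynomial_fun.scale [of n "\<lambda>z. z b ^ k * P z" c] by (simp add: mult.left_commute)
qed

definition vandermonde :: "nat \<Rightarrow> (nat \<Rightarrow> complex) \<Rightarrow> complex"
  where "vandermonde n z = (\<Prod>(i, j)\<in>{(i, j). 1 \<le> i \<and> i < j \<and> j \<le> n}. z i - z j)"

lemma finite_pairs: "finite {(i, j). 1 \<le> i \<and> i < j \<and> j \<le> (n :: nat)}"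
  by (rule finite_subset [of _ "{..n} \<times> {..n}"]) auto

lemma prod_pairs_Suc:
  fixes f :: "nat \<Rightarrow> nat \<Rightarrow> complex"
  shows "(\<Prod>(i, j)\<in>{(i, j). 1 \<le> i \<and> i < j \<and> j \<le> Suc n}. f i j) =
    (\<Prod>(i, j)\<in>{(i, j). 1 \<le> i \<and> i < j \<and> j \<le> n}. f i j) * (\<Prod>i=1..n. f i (Suc n))"
proof -
  have "{(i, j). 1 \<le> i \<and> i < j \<and> j \<le> Suc n} =
      {(i, j). 1 \<le> i \<and> i < j \<and> j \<le> n} \<union> (\<lambda>i. (i, Suc n)) ` {1..n}"
    by (auto simp: le_Suc_eq)
  then have "(\<Prod>(i, j)\<in>{(i, j). 1 \<le> i \<and> i < j \<and> j \<le> Suc n}. f i j) =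
      (\<Prod>(i, j)\<in>{(i, j). 1 \<le> i \<and> i < j \<and> j \<le> n}. f i j) *
      (\<Prod>(i, j)\<in>(\<lambda>i. (i, Suc n)) ` {1..n}. f i j)"
    using finite_pairs [of n] by (simp only:) (intro prod.union_disjoint; auto)
  also have "(\<Prod>(i, j)\<in>(\<lambda>i. (i, Suc n)) ` {1..n}. f i j) = (\<Prod>i=1..n. f i (Suc n))"
    by (subst prod.reindex) (auto simp: inj_on_def)
  finally show ?thesis .
qed

lemma vandermonde_Suc: "vandermonde (Suc n) z = vandermonde n z * (\<Prod>i=1..n. z i - z (Suc n))"
  unfolding vandermonde_def by (rule prod_pairs_Suc)

lemma polynomial_fun_vandermonde: "polynomial_fun n (vandermonde n)"
proof -
  have "polynomial_fun n (\<lambda>z. \<Prod>(i, j)\<in>S. z i - z j)"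
    if "finite S" "S \<subseteq> {(i, j). 1 \<le> i \<and> i < j \<and> j \<le> n}" for S
    using that
  proof (induction S rule: finite_induct)
    case empty then show ?case by (simp add: polynomial_fun_const)
  next
    case (insert p S)
    obtain i j where p: "p = (i, j)" "i \<in> {1..n}" "j \<in> {1..n}" using insert.prems by fastforce
    let ?P = "\<lambda>z. \<Prod>(i, j)\<in>S. z i - z j"
    have "polynomial_fun n (\<lambda>z. z i ^ 1 * ?P z + (- 1) * (z j ^ 1 * ?P z))"
      using insert p by (intro polynomial_fun.add polynomial_fun.scale polynomial_fun_coordinate) auto
    then show ?case using insert p by (simp add: algebra_simps)
  qed
  from this [OF finite_pairs subset_refl] show ?thesis by (simp add: vandermonde_def [abs_def])
qed

text \<open>
  An adjacent transposition permutes the pairs \<open>i < j\<close>, except that it reverses \<open>(c, c + 1)\<close>.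
\<close>

lemma vandermonde_swap:
  assumes "1 \<le> c" "c < n"
  shows "vandermonde n (z \<circ> Transposition.transpose c (Suc c)) = - vandermonde n z"
proof -
  define S where "S = {(i, j). 1 \<le> i \<and> i < j \<and> j \<le> n}"
  let ?t = "Transposition.transpose c (Suc c)"
  have S: "finite (S - {(c, Suc c)})" "(c, Suc c) \<in> S" "finite S"
    using assms finite_pairs [of n] by (auto simp: S_def)
  have v: "vandermonde n z = (z c - z (Suc c)) * (\<Prod>(i, j)\<in>S - {(c, Suc c)}. z i - z j)" for z
    unfolding vandermonde_def S_def [symmetric] using S(2,3) by (subst prod.remove) auto
  have "(\<Prod>(i, j)\<in>S - {(c, Suc c)}. z (?t i) - z (?t j)) = (\<Prod>(i, j)\<in>S - {(c, Suc c)}. z i - z j)"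
    by (rule prod.reindex_bij_witness [where i = "map_prod ?t ?t" and j = "map_prod ?t ?t"])
       (use assms in \<open>auto simp: S_def Transposition.transpose_def split: if_splits\<close>)
  then show ?thesis by (simp add: v algebra_simps)
qed

section \<open>Alternating functions\<close>

text \<open>
  For \<open>a < b\<close>, conjugation of \<open>(a b)\<close> with \<open>(b b+1)\<close> is \<open>(a b+1)\<close>.
\<close>

lemma alternating_transpose:
  fixes h :: "(nat \<Rightarrow> int) \<Rightarrow> complex"
  assumes alt: "\<And>j c. 1 \<le> c \<Longrightarrow> c < n \<Longrightarrow> h (j \<circ> Transposition.transpose c (Suc c)) = - h j"
    and "1 \<le> a" "a < b" "b \<le> n"
  shows "h (j \<circ> Transposition.transpose a b) = - h j"
  using \<open>a < b\<close> \<open>b \<le> n\<close>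
proof (induction b arbitrary: j)
  case (Suc b)
  show ?case
  proof (cases "a = b")
    case True
    show ?thesis unfolding True by (rule alt) (use True assms Suc.prems in auto)
  next
    case False
    have "Transposition.transpose a (Suc b) = Transposition.transpose b (Suc b) \<circ> Transposition.transpose a b \<circ> Transposition.transpose b (Suc b)"
      using False Suc.prems by (auto simp: fun_eq_iff Transposition.transpose_def)
    then have "j \<circ> Transposition.transpose a (Suc b) = j \<circ> Transposition.transpose b (Suc b) \<circ> Transposition.transpose a b \<circ> Transposition.transpose b (Suc b)"
      by (simp add: comp_assoc)
    moreover have "h (j \<circ> Transposition.transpose a b) = - h j" for j
      by (rule Suc.IH) (use False Suc.prems in auto)
    moreover have "h (j \<circ> Transposition.transpose b (Suc b)) = - h j" for j
      by (rule alt) (use \<open>1 \<le> a\<close> False Suc.prems in auto)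
    ultimately show ?thesis by (simp only: minus_minus)
  qed
qed auto

lemma alternating_repeated:
  fixes h :: "(nat \<Rightarrow> int) \<Rightarrow> complex"
  assumes alt: "\<And>j c. 1 \<le> c \<Longrightarrow> c < n \<Longrightarrow> h (j \<circ> Transposition.transpose c (Suc c)) = - h j"
    and "\<not> inj_on j {1..n}"
  shows "h j = 0"
proof -
  obtain a b where ab: "1 \<le> a" "a < b" "b \<le> n" "j a = j b"
    using assms(2) by (auto simp: inj_on_def) (metis nat_neq_iff)
  then have "j \<circ> Transposition.transpose a b = j" by (auto simp: fun_eq_iff Transposition.transpose_def)
  then show ?thesis using alternating_transpose [of n h a b j, OF alt ab(1-3)] by simp
qed

section \<open>Moments of the shifted powers\<close>

locale separating_circle =
  fixes \<alpha> \<beta> :: "int \<Rightarrow> complex" and r :: real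
  assumes beta_less: "\<And>a. cmod (\<beta> a) < r"
    and alpha_less: "\<And>b. r * cmod (\<alpha> b) < 1"
begin

lemma radius_pos: "0 < r"
  using beta_less [of 0] by (meson norm_ge_zero order_le_less_trans)

lemma alpha_factor: "cmod z \<le> r \<Longrightarrow> 1 - z * \<alpha> i \<noteq> 0"
proof
  assume z: "cmod z \<le> r" and "1 - z * \<alpha> i = 0"
  then have "cmod z * cmod (\<alpha> i) = 1" by (metis eq_iff_diff_eq_0 norm_mult norm_one)
  moreover have "cmod z * cmod (\<alpha> i) \<le> r * cmod (\<alpha> i)" using z by (rule mult_right_mono) simp
  ultimately show False using alpha_less [of i] by simp
qed

lemma beta_factor: "cmod z = r \<Longrightarrow> z - \<beta> i \<noteq> 0"
  using beta_less [of i] by auto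

lemma alpha_factor_eq: "cmod z \<le> r \<Longrightarrow> z * \<alpha> i \<noteq> 1"
  using alpha_factor [of z i] by simp

lemma beta_factor_eq: "cmod z = r \<Longrightarrow> z \<noteq> \<beta> i"
  using beta_factor [of z i] by simp

lemma alpha_beta: "1 - \<alpha> i * \<beta> j \<noteq> 0"
  using alpha_factor [of "\<beta> j" i] beta_less [of j] by (simp add: mult.commute)

text \<open>
  The part of the generating function that depends on one variable only, multiplied by the dual
  shifted power; see \<open>weight_eq_shifted_dual\<close>.
\<close>

definition weight :: "nat \<Rightarrow> int \<Rightarrow> complex \<Rightarrow> complex"
  where "weight n x w = (1 - \<alpha> x * \<beta> x) * apow w \<beta> (- int n) * mpow w \<alpha> (x - 1) / apow w \<beta> x"

definition moment :: "nat \<Rightarrow> nat \<Rightarrow> int \<Rightarrow> complex"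
  where "moment n e x = circle_mean r (\<lambda>w. w ^ e * weight n x w)"

lemma continuous_weight: "continuous_on (sphere 0 r) (weight n x)"
proof -
  have "continuous_on (sphere 0 r) (\<lambda>w. mpow w \<alpha> k)" for k
    unfolding mpow_def
    by (cases "0 \<le> k") (auto intro!: continuous_intros simp: alpha_factor_eq)
  moreover have "continuous_on (sphere 0 r) (\<lambda>w. apow w \<beta> k)" for k
    unfolding apow_def
    by (cases "0 \<le> k") (auto intro!: continuous_intros simp: beta_factor_eq)
  moreover have "apow w \<beta> x \<noteq> 0" if "w \<in> sphere 0 r" for w
    using that by (intro apow_nonzero beta_factor) simp
  ultimately show ?thesis unfolding weight_def [abs_def] by (intro continuous_intros) auto
qed

text \<open>
  For \<open>x \<le> -n\<close> all poles at the \<open>\<beta>\<^sub>i\<close> are cancelled by \<open>(w|\<beta>)\<^bsup>-n\<^esup>\<close>, and the poles at the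
  \<open>\<alpha>\<^sub>i\<^sup>-\<^sup>1\<close> lie outside the circle.
\<close>

lemma circle_mean_weight_below:
  assumes "f holomorphic_on cball 0 r" "x \<le> - int n"
  shows "circle_mean r (\<lambda>w. f w * weight n x w) = 0"
proof -
  define m where "m = nat (- int n - x)"
  have m: "- int n = x + int m" using assms by (simp add: m_def)
  let ?g = "\<lambda>w. f w * ((1 - \<alpha> x * \<beta> x) * ((\<Prod>i=x+1..- int n. w - \<beta> i) * (\<Prod>i=x..0. inverse (1 - w * \<alpha> i))))"
  have "circle_mean r (\<lambda>w. f w * weight n x w) = circle_mean r ?g"
  proof (rule circle_mean_cong [OF radius_pos])
    fix w assume w: "cmod w = r"
    have "apow w \<beta> (- int n) = apow w \<beta> x * (\<Prod>i=x+1..- int n. w - \<beta> i)"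
      using apow_add [of w \<beta> x m, folded m] beta_factor w by blast
    moreover have "mpow w \<alpha> (x - 1) = (\<Prod>i=x..0. inverse (1 - w * \<alpha> i))"
      using assms(2) by (simp add: mpow_def)
    moreover have "apow w \<beta> x \<noteq> 0" using w by (intro apow_nonzero beta_factor)
    ultimately show "f w * weight n x w = ?g w" by (simp add: weight_def)
  qed
  also have "\<dots> = 0"
    by (rule circle_mean_holomorphic [OF radius_pos])
       (auto intro!: holomorphic_intros assms simp: alpha_factor_eq)
  finally show ?thesis .
qed

lemma moment_below: "x \<le> - int n \<Longrightarrow> moment n e x = 0"
  unfolding moment_def by (rule circle_mean_weight_below) (auto intro!: holomorphic_intros)

lemma weight_recurrence:
  assumes "cmod w = r"
  shows "(1 - \<alpha> x * \<beta> x) * ((w - \<beta> (x+1)) * weight n (x+1) w) =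
    (1 - \<alpha> (x+1) * \<beta> (x+1)) * ((1 - w * \<alpha> x) * weight n x w)"
proof -
  have A: "\<And>i. 1 - w * \<alpha> i \<noteq> 0" and B: "\<And>i. w - \<beta> i \<noteq> 0"
    using assms by (auto simp: alpha_factor_eq beta_factor_eq)
  have "mpow w \<alpha> x = mpow w \<alpha> (x - 1) * (1 - w * \<alpha> x)"
    using mpow_Suc [of w \<alpha> "x - 1", OF A] by simp
  moreover have "apow w \<beta> (x+1) = apow w \<beta> x * (w - \<beta> (x+1))"
    by (rule apow_Suc [OF B])
  moreover have "weight n (x+1) w =
      (1 - \<alpha> (x+1) * \<beta> (x+1)) * apow w \<beta> (- int n) * mpow w \<alpha> x / apow w \<beta> (x+1)"
    by (simp add: weight_def)
  ultimately show ?thesis using B [of "x+1"] by (simp add: weight_def [of n x])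
qed

lemma moment_recurrence:
  "(1 - \<alpha> x * \<beta> x) * (moment n (Suc e) (x+1) - \<beta> (x+1) * moment n e (x+1)) =
   (1 - \<alpha> (x+1) * \<beta> (x+1)) * (moment n e x - \<alpha> x * moment n (Suc e) x)"
proof -
  let ?c = "1 - \<alpha> x * \<beta> x" and ?d = "1 - \<alpha> (x+1) * \<beta> (x+1)"
  have cont: "continuous_on (sphere 0 r) (\<lambda>w. w ^ e * weight n x w)" for e x
    by (intro continuous_intros continuous_weight)
  have lin: "a * moment n e x + b * moment n e' x' =
      circle_mean r (\<lambda>w. a * (w ^ e * weight n x w) + b * (w ^ e' * weight n x' w))" for a b e e' x x'
    unfolding moment_def using cont
    by (simp add: circle_mean_add circle_mean_mult radius_pos continuous_on_mult_left)
  have "?c * moment n (Suc e) (x+1) + (- ?c * \<beta> (x+1)) * moment n e (x+1) =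
        ?d * moment n e x + (- ?d * \<alpha> x) * moment n (Suc e) x"
    unfolding lin
  proof (rule circle_mean_cong [OF radius_pos])
    fix w assume w: "cmod w = r"
    show "?c * (w ^ Suc e * weight n (x+1) w) + (- ?c * \<beta> (x+1)) * (w ^ e * weight n (x+1) w) =
        ?d * (w ^ e * weight n x w) + (- ?d * \<alpha> x) * (w ^ Suc e * weight n x w)"
      using arg_cong [OF weight_recurrence [OF w, of x n], of "\<lambda>t. w ^ e * t"]
      by (simp add: algebra_simps)
  qed
  then show ?thesis by (simp add: algebra_simps)
qed

text \<open>
  Multiplication by \<open>z\<^sup>k\<close> acts on the weights through the matrix \<open>A\<^sup>k\<close>, up to functions whose
  integral against polynomials vanishes. Both sides satisfy the recurrence of
  \<open>current_coeff_recurrence\<close> in \<open>x\<close> and vanish for \<open>x \<le> -n\<close>; the step divides by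
  \<open>1 - \<alpha>\<^sub>x \<beta>\<^sub>x\<close>.
\<close>

lemma moment_shift:
  "(\<Sum>i=1 - int n..x. current_coeff \<alpha> \<beta> k i x * moment n e i) = moment n (e + k) x"
proof (induction k arbitrary: x)
  case 0
  show ?case
  proof (cases "1 - int n \<le> x")
    case True
    have "(\<Sum>i=1 - int n..x. current_coeff \<alpha> \<beta> 0 i x * moment n e i) =
        (\<Sum>i=1 - int n..x. if i = x then moment n e i else 0)"
      by (intro sum.cong) (auto simp: current_coeff_0)
    then show ?thesis using True by simp
  qed (simp add: moment_below)
next
  case (Suc k)
  let ?R = "\<lambda>k x. \<Sum>i=1 - int n..x. current_coeff \<alpha> \<beta> k i x * moment n e i"
  let ?c = "\<lambda>x. 1 - \<alpha> x * \<beta> x"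
  show ?case
  proof (cases "x \<le> - int n")
    case True
    then show ?thesis by (simp add: moment_below)
  next
    case False
    then have "- int n \<le> x" by simp
    then show ?thesis
    proof (induction x rule: int_ge_induct)
      case base then show ?case by (simp add: moment_below)
    next
      case (step x)
      \<comment> \<open>the summand \<open>i = x + 1\<close> vanishes, as the matrices are triangular\<close>
      have ext: "(\<Sum>i=1 - int n..x+1. current_coeff \<alpha> \<beta> l i x * moment n e i) = ?R l x" for l
        by (rule sum.mono_neutral_right) (auto simp: current_coeff_below)
      have "?c x * (?R (Suc k) (x+1) - \<beta> (x+1) * ?R k (x+1)) =
          (\<Sum>i=1 - int n..x+1. ?c x * (current_coeff \<alpha> \<beta> (Suc k) i (x+1) -
             \<beta> (x+1) * current_coeff \<alpha> \<beta> k i (x+1)) * moment n e i)"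
        by (simp add: sum_distrib_left sum_subtractf [symmetric] algebra_simps)
      also have "\<dots> = ?c (x+1) *
          ((\<Sum>i=1 - int n..x+1. current_coeff \<alpha> \<beta> k i x * moment n e i) -
           \<alpha> x * (\<Sum>i=1 - int n..x+1. current_coeff \<alpha> \<beta> (Suc k) i x * moment n e i))"
        unfolding current_coeff_recurrence
        by (simp add: sum_distrib_left sum_subtractf [symmetric] algebra_simps)
      also have "\<dots> = ?c (x+1) * (moment n (e + k) x - \<alpha> x * moment n (Suc (e + k)) x)"
        unfolding ext using Suc.IH step.IH by simp
      also have "\<dots> = ?c x * (moment n (Suc (e + k)) (x+1) - \<beta> (x+1) * moment n (e + k) (x+1))"
        by (rule moment_recurrence [symmetric])
      finally show ?case using alpha_beta [of x x] Suc.IH [of "x+1"] by simp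
    qed
  qed
qed

section \<open>The pairing of polynomials with weights\<close>

definition pairing :: "nat \<Rightarrow> ((nat \<Rightarrow> complex) \<Rightarrow> complex) \<Rightarrow> (nat \<Rightarrow> int) \<Rightarrow> complex"
  where "pairing n P j = torus_integral r n (\<lambda>z. P z * (\<Prod>i=1..n. weight n (j i) (z i)))"

lemma separable_weighted:
  "polynomial_fun n P \<Longrightarrow> separable r n (\<lambda>z. P z * (\<Prod>i=1..n. weight m (j i) (z i)))"
proof (induction rule: polynomial_fun.induct)
  case (monomial e)
  have "separable r n (\<lambda>z. \<Prod>i=1..n. z i ^ e i * weight m (j i) (z i))"
    by (rule separable.product) (intro continuous_intros continuous_weight)
  then show ?case by (simp add: prod.distrib)
next
  case (add P Q)
  then show ?case by (simp add: distrib_right separable.add)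
next
  case (scale P c)
  then show ?case using separable.scale by (simp add: mult.assoc)
qed

text \<open>All further properties of the pairing follow from this case by linearity.\<close>

lemma pairing_monomial: "pairing n (\<lambda>z. \<Prod>i=1..n. z i ^ e i) j = (\<Prod>i=1..n. moment n (e i) (j i))"
proof -
  have "pairing n (\<lambda>z. \<Prod>i=1..n. z i ^ e i) j =
      torus_integral r n (\<lambda>z. \<Prod>i=1..n. z i ^ e i * weight n (j i) (z i))"
    by (simp add: pairing_def prod.distrib)
  also have "\<dots> = (\<Prod>i=1..n. circle_mean r (\<lambda>w. w ^ e i * weight n (j i) w))"
    by (rule torus_integral_product [OF radius_pos]) (intro continuous_intros continuous_weight)
  finally show ?thesis by (simp add: moment_def)
qed

lemma pairing_add:
  "polynomial_fun n P \<Longrightarrow> polynomial_fun n Q \<Longrightarrow> pairing n (\<lambda>z. P z + Q z) j = pairing n P j + pairing n Q j"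
  unfolding pairing_def distrib_right
  by (rule torus_integral_add [OF radius_pos separable_weighted separable_weighted])

lemma pairing_scale: "polynomial_fun n P \<Longrightarrow> pairing n (\<lambda>z. c * P z) j = c * pairing n P j"
  unfolding pairing_def mult.assoc
  by (rule torus_integral_mult [OF radius_pos separable_weighted])

lemma pairing_sum:
  "finite I \<Longrightarrow> (\<And>i. i \<in> I \<Longrightarrow> polynomial_fun n (P i)) \<Longrightarrow>
   pairing n (\<lambda>z. \<Sum>i\<in>I. P i z) j = (\<Sum>i\<in>I. pairing n (P i) j)"
proof (induction I rule: finite_induct)
  case empty
  show ?case using pairing_scale [OF polynomial_fun_const, of n 0 1 j] by simp
next
  case (insert x I)
  then show ?case by (simp add: pairing_add polynomial_fun_sum)
qed

text \<open>
  The counterpart, for the variable \<open>z\<^sub>a\<close>, of the commutator of a current with \<open>\<psi>\<^bsub>j\<^sub>a\<^esub>\<close>.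
\<close>

lemma pairing_coordinate_power:
  assumes "polynomial_fun n P" "a \<in> {1..n}"
  shows "(\<Sum>i=1 - int n..j a. current_coeff \<alpha> \<beta> k i (j a) * pairing n P (j(a := i))) =
         pairing n (\<lambda>z. z a ^ k * P z) j"
  using assms
proof (induction rule: polynomial_fun.induct)
  case (monomial e)
  have upd: "(\<Prod>i=1..n. moment n (f i) (g i)) =
      moment n (f a) (g a) * (\<Prod>i\<in>{1..n} - {a}. moment n (f i) (g i))" for f g
    using monomial by (intro prod.remove) auto
  have "(\<Sum>i=1 - int n..j a. current_coeff \<alpha> \<beta> k i (j a) *
      pairing n (\<lambda>z. \<Prod>b=1..n. z b ^ e b) (j(a := i))) =
    (\<Sum>i=1 - int n..j a. current_coeff \<alpha> \<beta> k i (j a) * moment n (e a) i) *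
    (\<Prod>i\<in>{1..n} - {a}. moment n (e i) (j i))"
    unfolding pairing_monomial sum_distrib_right upd
    by (intro sum.cong refl) (simp del: One_nat_def)
  also have "\<dots> = moment n (e a + k) (j a) * (\<Prod>i\<in>{1..n} - {a}. moment n (e i) (j i))"
    by (simp only: moment_shift)
  also have "\<dots> = pairing n (\<lambda>z. z a ^ k * (\<Prod>b=1..n. z b ^ e b)) j"
    unfolding monomial_times_coordinate [OF monomial] pairing_monomial upd
    by (simp del: One_nat_def)
  finally show ?case .
next
  case (add P Q)
  then show ?case
    by (simp add: pairing_add distrib_left sum.distrib polynomial_fun_coordinate)
next
  case (scale P c)
  have "pairing n (\<lambda>z. z a ^ k * (c * P z)) j = pairing n (\<lambda>z. c * (z a ^ k * P z)) j"
    by (simp add: mult.left_commute)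
  then show ?case using scale
    by (simp add: pairing_scale polynomial_fun_coordinate mult.left_commute flip: sum_distrib_left)
qed

lemma pairing_permute:
  assumes "polynomial_fun n P" and p: "p permutes {1..n}"
  shows "pairing n (\<lambda>z. P (z \<circ> p)) j = pairing n P (j \<circ> p) \<and> polynomial_fun n (\<lambda>z. P (z \<circ> p))"
  using assms(1)
proof (induction rule: polynomial_fun.induct)
  case (monomial e)
  have re: "(\<Prod>i=1..n. f (p i)) = (\<Prod>i=1..n. f i)" for f :: "nat \<Rightarrow> complex"
    using prod.permute [OF p, of f] by (simp add: o_def)
  have inv: "inv p (p i) = i" for i using p by (simp add: permutes_inverses)
  have "(\<Prod>i=1..n. (z \<circ> p) i ^ e i) = (\<Prod>i=1..n. z i ^ e (inv p i))" for z :: "nat \<Rightarrow> complex"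
    using re [of "\<lambda>i. z i ^ e (inv p i)"] by (simp add: inv)
  moreover have "(\<Prod>i=1..n. moment n (e (inv p i)) (j i)) = (\<Prod>i=1..n. moment n (e i) ((j \<circ> p) i))"
    using re [of "\<lambda>i. moment n (e (inv p i)) (j i)"] by (simp add: inv)
  ultimately show ?case by (simp only: pairing_monomial polynomial_fun.monomial)
next
  case (add P Q)
  then show ?case by (simp add: pairing_add polynomial_fun.add)
next
  case (scale P c)
  then show ?case by (simp add: pairing_scale polynomial_fun.scale)
qed

lemma pairing_vandermonde_alternating:
  assumes "1 \<le> c" "c < n"
  shows "pairing n (vandermonde n) (j \<circ> Transposition.transpose c (Suc c)) = - pairing n (vandermonde n) j"
proof -
  have "Transposition.transpose c (Suc c) permutes {1..n}"
    using assms by (intro permutes_swap_id) auto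
  then have "pairing n (vandermonde n) (j \<circ> Transposition.transpose c (Suc c)) =
      pairing n (\<lambda>z. vandermonde n (z \<circ> Transposition.transpose c (Suc c))) j"
    using pairing_permute [OF polynomial_fun_vandermonde] by simp
  also have "\<dots> = pairing n (\<lambda>z. (- 1) * vandermonde n z) j"
    using assms by (simp add: vandermonde_swap)
  finally show ?thesis by (simp only: pairing_scale [OF polynomial_fun_vandermonde]) simp
qed

text \<open>
  The last variable occurs in the Vandermonde product only through the factors \<open>z\<^sub>i - w\<close>,
  so the inner integral is a circle mean of these factors times a single weight.
\<close>

lemma pairing_vandermonde_Suc:
  "pairing (Suc n) (vandermonde (Suc n)) j =
   torus_integral r n (\<lambda>z. vandermonde n z * (\<Prod>i=1..n. weight (Suc n) (j i) (z i)) *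
     circle_mean r (\<lambda>w. (\<Prod>i=1..n. z i - w) * weight (Suc n) (j (Suc n)) w))"
proof -
  have vd: "vandermonde n (z(Suc n := w)) = vandermonde n z" for z w
    unfolding vandermonde_def by (intro prod.cong) auto
  have "vandermonde (Suc n) (z(Suc n := w)) * (\<Prod>i=1..Suc n. weight (Suc n) (j i) ((z(Suc n := w)) i)) =
      (vandermonde n z * (\<Prod>i=1..n. weight (Suc n) (j i) (z i))) *
      ((\<Prod>i=1..n. z i - w) * weight (Suc n) (j (Suc n)) w)" for z w
    by (simp add: vandermonde_Suc vd prod.nat_ivl_Suc')
  moreover have "continuous_on (sphere 0 r) (\<lambda>w. (\<Prod>i=1..n. z i - w) * weight (Suc n) x w)" for z x
    by (intro continuous_intros continuous_weight)
  ultimately show ?thesis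
    unfolding pairing_def torus_integral_Suc by (simp only: circle_mean_mult [OF radius_pos])
qed

text \<open>
  For \<open>x \<ge> 1\<close> the integrand has no poles outside the circle and is \<open>O(w\<^sup>-\<^sup>2)\<close> at infinity: the
  product has degree \<open>n\<close>, one less than the number of variables. Substituting \<open>w = 1/u\<close> makes it
  holomorphic inside.
\<close>

lemma circle_mean_weight_above:
  assumes "1 \<le> x"
  shows "circle_mean r (\<lambda>w. (\<Prod>i=1..n. z i - w) * weight (Suc n) x w) = 0"
proof -
  define m where "m = nat (x - 1)"
  have m: "x = - int (Suc n) + int (n + m + 2)" and m': "x - 1 = int m" using assms by (auto simp: m_def)
  let ?g = "\<lambda>w. (\<Prod>i=1..n. z i - w) * ((1 - \<alpha> x * \<beta> x) * (\<Prod>i=1..x-1. 1 - w * \<alpha> i) / (\<Prod>i=- int n..x. w - \<beta> i))"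
  have "circle_mean r (\<lambda>w. (\<Prod>i=1..n. z i - w) * weight (Suc n) x w) = circle_mean r ?g"
  proof (rule circle_mean_cong [OF radius_pos])
    fix w assume w: "cmod w = r"
    have "apow w \<beta> x = apow w \<beta> (- int (Suc n)) * (\<Prod>i=- int n..x. w - \<beta> i)"
      using apow_add [of w \<beta> "- int (Suc n)" "n + m + 2", folded m] beta_factor w by simp
    moreover have "mpow w \<alpha> (x - 1) = (\<Prod>i=1..x-1. 1 - w * \<alpha> i)"
      using assms by (simp add: mpow_def)
    moreover have "apow w \<beta> (- int (Suc n)) \<noteq> 0" using w by (intro apow_nonzero beta_factor)
    ultimately show "(\<Prod>i=1..n. z i - w) * weight (Suc n) x w = ?g w"
      unfolding weight_def by simp
  qed
  also have "\<dots> = circle_mean (1 / r) (\<lambda>u. ?g (1 / u) / u\<^sup>2)"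
    unfolding circle_mean_def using contour_integral_circlepath_inverse [OF radius_pos] by simp
  also have "\<dots> = circle_mean (1 / r) (\<lambda>u. (\<Prod>i=1..n. z i * u - 1) *
      ((1 - \<alpha> x * \<beta> x) * (\<Prod>i=1..x-1. u - \<alpha> i) / (\<Prod>i=- int n..x. 1 - u * \<beta> i)))"
  proof (rule circle_mean_cong)
    show "0 < 1 / r" using radius_pos by simp
    fix u assume "cmod u = 1 / r"
    then have u: "u \<noteq> 0" using radius_pos by auto
    have "(\<Prod>i=1..n. z i - 1 / u) = (\<Prod>i=1..n. (z i * u - 1) / u)"
      using u by (intro prod.cong) (auto simp: field_simps)
    then have 1: "(\<Prod>i=1..n. z i - 1 / u) = (\<Prod>i=1..n. z i * u - 1) / u ^ n"
      by (simp add: prod_dividef)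
    have "(\<Prod>i=1..x-1. 1 - 1 / u * \<alpha> i) = (\<Prod>i=1..x-1. (u - \<alpha> i) / u)"
      using u by (intro prod.cong) (auto simp: field_simps)
    then have 2: "(\<Prod>i=1..x-1. 1 - 1 / u * \<alpha> i) = (\<Prod>i=1..x-1. u - \<alpha> i) / u ^ m"
      by (simp add: prod_dividef m')
    \<comment> \<open>the denominator has \<open>n + m + 2\<close> factors: this cancels \<open>u\<^sup>n\<close>, \<open>u\<^sup>m\<close> and the \<open>u\<^sup>2\<close> of the substitution\<close>
    have "card {- int n..x} = n + m + 2" using m by simp
    moreover have "(\<Prod>i=- int n..x. 1 / u - \<beta> i) = (\<Prod>i=- int n..x. (1 - u * \<beta> i) / u)"
      using u by (intro prod.cong) (auto simp: field_simps)
    ultimately have 3: "(\<Prod>i=- int n..x. 1 / u - \<beta> i) = (\<Prod>i=- int n..x. 1 - u * \<beta> i) / u ^ (n + m + 2)"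
      by (simp only: prod_dividef prod_constant)
    show "?g (1 / u) / u\<^sup>2 = (\<Prod>i=1..n. z i * u - 1) *
        ((1 - \<alpha> x * \<beta> x) * (\<Prod>i=1..x-1. u - \<alpha> i) / (\<Prod>i=- int n..x. 1 - u * \<beta> i))"
      unfolding 1 2 3 using u by (simp add: power_add power2_eq_square)
  qed
  also have "\<dots> = 0"
  proof (rule circle_mean_holomorphic)
    show "0 < 1 / r" using radius_pos by simp
    have "1 - u * \<beta> i \<noteq> 0" if "cmod u \<le> 1 / r" for u i
    proof
      assume "1 - u * \<beta> i = 0"
      then have "cmod u * cmod (\<beta> i) = 1" by (metis eq_iff_diff_eq_0 norm_mult norm_one)
      moreover have "cmod u * cmod (\<beta> i) \<le> 1 / r * cmod (\<beta> i)" using that by (rule mult_right_mono) simp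
      moreover have "1 / r * cmod (\<beta> i) < 1" using beta_less [of i] radius_pos by (simp add: field_simps)
      ultimately show False by simp
    qed
    then show "(\<lambda>u. (\<Prod>i=1..n. z i * u - 1) * ((1 - \<alpha> x * \<beta> x) * (\<Prod>i=1..x-1. u - \<alpha> i) /
        (\<Prod>i=- int n..x. 1 - u * \<beta> i))) holomorphic_on cball 0 (1 / r)"
      by (auto intro!: holomorphic_intros)
  qed
  finally show ?thesis .
qed

lemma pairing_vandermonde_last_0:
  assumes "1 \<le> j (Suc n) \<or> j (Suc n) \<le> - int (Suc n)"
  shows "pairing (Suc n) (vandermonde (Suc n)) j = 0"
proof -
  have "(\<lambda>w. \<Prod>i=1..n. z i - w) holomorphic_on cball 0 r" for z
    by (intro holomorphic_intros)
  then have "circle_mean r (\<lambda>w. (\<Prod>i=1..n. z i - w) * weight (Suc n) (j (Suc n)) w) = 0" for z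
    using assms circle_mean_weight_above circle_mean_weight_below by blast
  moreover have "torus_integral r n (\<lambda>_. 0) = 0"
    using pairing_scale [OF polynomial_fun_const, of n 0 1] by (simp add: pairing_def)
  ultimately show ?thesis by (simp add: pairing_vandermonde_Suc)
qed

text \<open>
  For \<open>x = -n\<close> the only pole inside the circle is the simple one at \<open>\<beta>\<^bsub>-n\<^esub>\<close>.
\<close>

lemma circle_mean_weight_residue:
  "circle_mean r (\<lambda>w. (\<Prod>i=1..n. z i - w) * weight (Suc n) (- int n) w) =
   (\<Prod>i=1..n. z i - \<beta> (- int n)) / (\<Prod>i=1..n. 1 - \<alpha> (1 - int i) * \<beta> (- int n))"
proof -
  let ?b = "\<beta> (- int n)"
  let ?f = "\<lambda>w. (\<Prod>i=1..n. z i - w) * ((1 - \<alpha> (- int n) * ?b) * (\<Prod>i=- int n..0. inverse (1 - w * \<alpha> i)))"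
  have "circle_mean r (\<lambda>w. (\<Prod>i=1..n. z i - w) * weight (Suc n) (- int n) w) =
      circle_mean r (\<lambda>w. ?f w / (w - ?b))"
  proof (rule circle_mean_cong [OF radius_pos])
    fix w assume w: "cmod w = r"
    have B: "\<And>i. w - \<beta> i \<noteq> 0" using w by (rule beta_factor)
    have "apow w \<beta> (- int n) = apow w \<beta> (- int (Suc n)) * (w - ?b)"
      using apow_Suc [of w \<beta> "- int (Suc n)", OF B] by simp
    moreover have "mpow w \<alpha> (- int n - 1) = (\<Prod>i=- int n..0. inverse (1 - w * \<alpha> i))"
      by (simp add: mpow_def)
    moreover have "apow w \<beta> (- int (Suc n)) \<noteq> 0" using B by (rule apow_nonzero)
    ultimately show "(\<Prod>i=1..n. z i - w) * weight (Suc n) (- int n) w = ?f w / (w - ?b)"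
      unfolding weight_def by simp
  qed
  also have "\<dots> = ?f ?b"
    by (rule circle_mean_Cauchy [OF radius_pos])
       (auto intro!: holomorphic_intros simp: alpha_factor_eq beta_less)
  finally have "circle_mean r (\<lambda>w. (\<Prod>i=1..n. z i - w) * weight (Suc n) (- int n) w) = ?f ?b" .
  moreover have "(\<Prod>i=- int n..0. inverse (1 - ?b * \<alpha> i)) =
      inverse (1 - \<alpha> (- int n) * ?b) * inverse (\<Prod>i=1..n. 1 - \<alpha> (1 - int i) * ?b)"
  proof -
    have "{- int n..0} = insert (- int n) {1 - int n..0}" by auto
    moreover have "(\<Prod>i=1 - int n..0. inverse (1 - ?b * \<alpha> i)) = (\<Prod>i=1..n. inverse (1 - \<alpha> (1 - int i) * ?b))"
      by (rule prod.reindex_bij_witness [where i = "\<lambda>i. 1 - int i" and j = "\<lambda>i. nat (1 - i)"])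
         (auto simp: mult.commute)
    ultimately show ?thesis by (simp add: prod_inversef [symmetric] mult.commute)
  qed
  moreover have "c * (inverse c * y) = y" if "c \<noteq> 0" for c y :: complex
    using that by simp
  ultimately show ?thesis by (simp only: alpha_beta divide_inverse simp_thms)
qed

text \<open>
  The constant that remains when the linear factors \<open>z\<^sub>i - z\<^sub>j\<close> are taken out of the double product
  of the generating function.
\<close>

definition vandermonde_norm :: "nat \<Rightarrow> complex"
  where "vandermonde_norm n =
    (\<Prod>(i, j)\<in>{(i, j). 1 \<le> i \<and> i < j \<and> j \<le> n}. 1 - \<alpha> (1 - int i) * \<beta> (1 - int j))"

lemma vandermonde_norm_Suc:
  "vandermonde_norm (Suc n) = vandermonde_norm n * (\<Prod>i=1..n. 1 - \<alpha> (1 - int i) * \<beta> (- int n))"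
  unfolding vandermonde_norm_def using prod_pairs_Suc [of "\<lambda>i j. 1 - \<alpha> (1 - int i) * \<beta> (1 - int j)" n]
  by simp

text \<open>
  The residue produces \<open>z\<^sub>i - \<beta>\<^bsub>-n\<^esub>\<close> for each remaining variable, which turns the weight for \<open>n + 1\<close>
  variables into that for \<open>n\<close> variables; the denominator of the residue is the quotient of the two
  normalizations.
\<close>

lemma pairing_vandermonde_last:
  assumes "j (Suc n) = - int n"
  shows "vandermonde_norm (Suc n) * pairing (Suc n) (vandermonde (Suc n)) j =
    vandermonde_norm n * pairing n (vandermonde n) j"
proof -
  let ?b = "\<beta> (- int n)"
  let ?C = "\<Prod>i=1..n. 1 - \<alpha> (1 - int i) * ?b"
  have C: "?C \<noteq> 0" using alpha_beta by simp
  have "pairing (Suc n) (vandermonde (Suc n)) j =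
      torus_integral r n (\<lambda>z. inverse ?C * (vandermonde n z * (\<Prod>i=1..n. weight n (j i) (z i))))"
    unfolding pairing_vandermonde_Suc assms circle_mean_weight_residue
  proof (rule torus_integral_cong [OF radius_pos])
    fix z assume z: "cmod (z a) = r" if "a \<in> {1..n}" for a
    have "(\<Prod>i=1..n. weight (Suc n) (j i) (z i)) * (\<Prod>i=1..n. z i - ?b) = (\<Prod>i=1..n. weight n (j i) (z i))"
      unfolding prod.distrib [symmetric]
    proof (rule prod.cong)
      fix i assume "i \<in> {1..n}"
      then have B: "\<And>l. z i - \<beta> l \<noteq> 0" using z by (auto simp: beta_factor_eq)
      have "apow (z i) \<beta> (- int n) = apow (z i) \<beta> (- int (Suc n)) * (z i - ?b)"
        using apow_Suc [of "z i" \<beta> "- int (Suc n)", OF B] by simp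
      then show "weight (Suc n) (j i) (z i) * (z i - ?b) = weight n (j i) (z i)"
        unfolding weight_def by simp
    qed simp
    then show "vandermonde n z * (\<Prod>i=1..n. weight (Suc n) (j i) (z i)) * ((\<Prod>i=1..n. z i - ?b) / ?C) =
        inverse ?C * (vandermonde n z * (\<Prod>i=1..n. weight n (j i) (z i)))"
      by (simp add: field_simps)
  qed
  also have "\<dots> = inverse ?C * pairing n (vandermonde n) j"
    unfolding pairing_def
    by (rule torus_integral_mult [OF radius_pos]) (rule separable_weighted [OF polynomial_fun_vandermonde])
  finally show ?thesis using C by (simp add: vandermonde_norm_Suc)
qed

end

section \<open>Fermions and currents\<close>

lemma fock_expand: "v = (\<Sum>S\<in>Poly_Mapping.keys v. fock_scale (Poly_Mapping.lookup v S) (fock_basis S))"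
proof (rule poly_mapping_eqI)
  fix S
  have "Poly_Mapping.lookup (\<Sum>T\<in>Poly_Mapping.keys v. fock_scale (Poly_Mapping.lookup v T) (fock_basis T)) S =
      (\<Sum>T\<in>Poly_Mapping.keys v. if T = S then Poly_Mapping.lookup v T else 0)"
    unfolding lookup_sum fock_scale.rep_eq fock_basis_def lookup_single when_def
    by (intro sum.cong) auto
  also have "\<dots> = Poly_Mapping.lookup v S" by (simp add: in_keys_iff)
  finally show "Poly_Mapping.lookup v S =
      Poly_Mapping.lookup (\<Sum>T\<in>Poly_Mapping.keys v. fock_scale (Poly_Mapping.lookup v T) (fock_basis T)) S" by simp
qed

text \<open>Linear statements need to be checked on multiples of basis vectors only.\<close>

lemma fock_induct [case_names add basis]:
  assumes "\<And>u v. P u \<Longrightarrow> P v \<Longrightarrow> P (u + v)" and "\<And>c S. P (fock_scale c (fock_basis S))"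
  shows "P v"
proof -
  have 0: "P 0" using assms(2) [of 0] by simp
  have "P (\<Sum>S\<in>K. fock_scale (f S) (fock_basis S))" if "finite K" for K f
    using that by (induction K rule: finite_induct) (use 0 assms in auto)
  then show ?thesis by (subst fock_expand) simp
qed

lemma app_add: "app T (u + v) = app T u + app T v"
  using fock_pair.linear_add [OF app_linear] .

lemma app_diff: "app T (u - v) = app T u - app T v"
  using fock_pair.linear_diff [OF app_linear] .

lemma app_sum: "app T (\<Sum>i\<in>I. f i) = (\<Sum>i\<in>I. app T (f i))"
  using fock_pair.linear_sum [OF app_linear] .

lemma app_times: "app (S * T) v = app S (app T v)"
  by (simp add: times_fock_op.rep_eq)

lemma app_plus: "app (S + T) v = app S v + app T v"
  by (simp add: plus_fock_op.rep_eq)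

lemma app_uminus: "app (- T) v = - app T v"
  by (simp add: uminus_fock_op.rep_eq)

lemma app_zero_op [simp]: "app 0 v = 0"
  by (simp add: zero_fock_op.rep_eq)

lemma app_one [simp]: "app 1 v = v"
  by (simp add: one_fock_op.rep_eq)

lemma app_sum_op: "app (\<Sum>i\<in>I. T i) v = (\<Sum>i\<in>I. app (T i) v)"
  by (induction I rule: infinite_finite_induct) (simp_all add: app_plus)

lemma app_scaleR: "app (c *\<^sub>R T) v = fock_scale (of_real c) (app T v)"
  by (simp add: scaleR_fock_op.rep_eq)

lemma fock_op_eq_on_basis:
  assumes "\<And>S. app T (fock_basis S) = app U (fock_basis S)"
  shows "T = U"
proof (rule fock_op_eqI)
  fix v show "app T v = app U v"
    by (induction v rule: fock_induct) (simp_all add: app_add app_scale assms)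
qed

lemma maya_eqI: "occupied S = occupied T \<Longrightarrow> S = T"
  by (simp add: occupied_inject)

lemma finite_occupied_above: "finite {s \<in> occupied S. j < s}"
proof -
  have "finite ({i \<in> occupied S. 0 < i} \<union> {j..0})" using occupied [of S] by auto
  then show ?thesis by (rule finite_subset [rotated]) auto
qed

lemma wedge_sign_insert:
  assumes "j \<notin> occupied S"
  shows "wedge_sign i (maya_insert j S) = (if i < j then - wedge_sign i S else wedge_sign i S)"
proof -
  have "{s \<in> occupied (maya_insert j S). i < s} =
      (if i < j then insert j {s \<in> occupied S. i < s} else {s \<in> occupied S. i < s})"
    by (auto simp: maya_insert.rep_eq)
  then show ?thesis using assms finite_occupied_above [of S i] by (simp add: wedge_sign_def)
qed

lemma wedge_sign_remove:
  assumes "j \<in> occupied S"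
  shows "wedge_sign i (maya_remove j S) = (if i < j then - wedge_sign i S else wedge_sign i S)"
proof -
  have "maya_insert j (maya_remove j S) = S"
    using assms by (intro maya_eqI) (auto simp: maya_insert.rep_eq maya_remove.rep_eq)
  moreover have "j \<notin> occupied (maya_remove j S)" by (simp add: maya_remove.rep_eq)
  ultimately show ?thesis using wedge_sign_insert [of j "maya_remove j S" i] by simp
qed

lemma wedge_sign_square: "wedge_sign i S * wedge_sign i S = 1"
  by (simp add: wedge_sign_def flip: power_add)

lemma psi_basis: "app (psi j) (fock_basis S) =
    (if j \<in> occupied S then 0 else fock_scale (wedge_sign j S) (fock_basis (maya_insert j S)))"
  by (simp add: psi_def)

lemma psi_star_basis: "app (psi_star j) (fock_basis S) =
    (if j \<in> occupied S then fock_scale (wedge_sign j S) (fock_basis (maya_remove j S)) else 0)"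
  by (simp add: psi_star_def)

lemma psi_anticommute: "psi i * psi j = - (psi j * psi i)"
proof (rule fock_op_eq_on_basis)
  fix S
  have "maya_insert i (maya_insert j S) = maya_insert j (maya_insert i S)"
    by (rule maya_eqI) (auto simp: maya_insert.rep_eq)
  then show "app (psi i * psi j) (fock_basis S) = app (- (psi j * psi i)) (fock_basis S)"
    by (cases i j rule: linorder_cases)
       (auto simp: app_times app_uminus psi_basis app_scale maya_insert.rep_eq wedge_sign_insert mult.commute)
qed

text \<open>
  The canonical anticommutation relation, oriented so that contractions move to the right.
\<close>

lemma psi_star_psi: "psi_star l * psi i = (if i = l then 1 else 0) - psi i * psi_star l"
proof (rule fock_op_eq_on_basis)
  fix S
  have ex: "maya_insert i (maya_remove l S) = maya_remove l (maya_insert i S)" if "i \<noteq> l"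
    using that by (intro maya_eqI) (auto simp: maya_insert.rep_eq maya_remove.rep_eq)
  have id: "i \<in> occupied S \<Longrightarrow> maya_insert i (maya_remove i S) = S"
     "i \<notin> occupied S \<Longrightarrow> maya_remove i (maya_insert i S) = S" for i
    by (rule maya_eqI; auto simp: maya_insert.rep_eq maya_remove.rep_eq)+
  show "app (psi_star l * psi i) (fock_basis S) =
      app ((if i = l then 1 else 0) - psi i * psi_star l) (fock_basis S)"
  proof (cases "i = l")
    case True
    then show ?thesis
      by (auto simp: app_times minus_fock_op.rep_eq psi_basis psi_star_basis app_scale maya_insert.rep_eq
         maya_remove.rep_eq wedge_sign_insert wedge_sign_remove wedge_sign_square id)
  next
    case False
    then show ?thesis
      by (auto simp: app_times minus_fock_op.rep_eq psi_basis psi_star_basis app_scale maya_insert.rep_eq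
         maya_remove.rep_eq wedge_sign_insert wedge_sign_remove ex mult.commute app_uminus)
  qed
qed

lemma normal_ordered_eq:
  "normal_ordered i l = psi i * psi_star l - (if i = l \<and> i \<le> 0 then 1 else 0)"
  by (simp add: normal_ordered_def psi_star_psi)

lemma normal_ordered_psi:
  "normal_ordered i l * psi j = psi j * normal_ordered i l + (if l = j then psi i else 0)"
proof -
  have "psi i * psi_star l * psi j = psi i * ((if j = l then 1 else 0) - psi j * psi_star l)"
    by (simp only: mult.assoc psi_star_psi)
  also have "\<dots> = (if l = j then psi i else 0) - (psi i * psi j) * psi_star l"
    by (simp add: right_diff_distrib mult.assoc)
  also have "\<dots> = psi j * (psi i * psi_star l) + (if l = j then psi i else 0)"
    unfolding psi_anticommute [of i j] by (simp add: mult.assoc)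
  finally show ?thesis by (simp add: normal_ordered_eq left_diff_distrib right_diff_distrib)
qed

text \<open>
  A current is an infinite sum of operators, but on each vector it agrees with all sufficiently
  large finite truncations, and with these one can compute in the ring of operators.
\<close>

lemma current_eventually:
  "\<exists>N0. \<forall>N\<ge>N0. app (current \<alpha> \<beta> k) v =
     (\<Sum>i=-N..N. \<Sum>l=-N..N. fock_scale (current_coeff \<alpha> \<beta> k i l) (app (normal_ordered i l) v))"
proof (induction v rule: fock_induct)
  case (add u v)
  then obtain N1 N2 where N1: "\<And>N. N \<ge> N1 \<Longrightarrow> app (current \<alpha> \<beta> k) u =
     (\<Sum>i=-N..N. \<Sum>l=-N..N. fock_scale (current_coeff \<alpha> \<beta> k i l) (app (normal_ordered i l) u))"
    and N2: "\<And>N. N \<ge> N2 \<Longrightarrow> app (current \<alpha> \<beta> k) v =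
     (\<Sum>i=-N..N. \<Sum>l=-N..N. fock_scale (current_coeff \<alpha> \<beta> k i l) (app (normal_ordered i l) v))"
    by blast
  show ?case
  proof (intro exI [of _ "max N1 N2"] allI impI)
    fix N assume "max N1 N2 \<le> N"
    then show "app (current \<alpha> \<beta> k) (u + v) =
        (\<Sum>i=-N..N. \<Sum>l=-N..N. fock_scale (current_coeff \<alpha> \<beta> k i l) (app (normal_ordered i l) (u + v)))"
      using N1 [of N] N2 [of N] by (simp add: app_add fock.scale_right_distrib sum.distrib)
  qed
next
  case (basis c S)
  let ?f = "\<lambda>(i, l). fock_scale (current_coeff \<alpha> \<beta> k i l) (app (normal_ordered i l) (fock_basis S))"
  define D where "D = {p. ?f p \<noteq> 0}"
  have D: "finite D" using finite_current_terms [of \<alpha> \<beta> k S] by (simp add: D_def case_prod_unfold)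
  define N0 where "N0 = Max (insert 0 ((\<lambda>(i, l). max \<bar>i\<bar> \<bar>l\<bar>) ` D))"
  have N0: "\<bar>i\<bar> \<le> N0 \<and> \<bar>l\<bar> \<le> N0" if "(i, l) \<in> D" for i l
  proof -
    have "max \<bar>i\<bar> \<bar>l\<bar> \<le> N0" unfolding N0_def using D that by (intro Max_ge) force+
    then show ?thesis by simp
  qed
  have "app (current \<alpha> \<beta> k) (fock_basis S) = (\<Sum>i=-N..N. \<Sum>l=-N..N. ?f (i, l))" if "N0 \<le> N" for N
  proof -
    have "app (current \<alpha> \<beta> k) (fock_basis S) = Sum_any ?f" by (simp add: current_def)
    also have "\<dots> = (\<Sum>p\<in>{-N..N} \<times> {-N..N}. ?f p)"
    proof (rule Sum_any.expand_superset)
      show "{p. ?f p \<noteq> 0} \<subseteq> {-N..N} \<times> {-N..N}"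
        using N0 that unfolding D_def [symmetric] by fastforce
    qed simp
    finally show ?thesis by (simp add: sum.cartesian_product)
  qed
  then show ?case
    by (intro exI [of _ N0]) (simp add: app_scale fock.scale_sum_right mult.commute)
qed

text \<open>
  The commutator \<open>[J\<^sub>k, \<psi>\<^sub>j] = \<Sum>\<^sub>i A\<^sup>k\<^bsub>ij\<^esub> \<psi>\<^sub>i\<close> is an infinite sum. It becomes finite on vectors that are
  annihilated by all \<open>\<psi>\<^sub>i\<close> of small index.
\<close>

lemma current_psi:
  assumes low: "\<And>i. i < m \<Longrightarrow> app (psi i) v = 0"
  shows "app (current \<alpha> \<beta> k) (app (psi j) v) = app (psi j) (app (current \<alpha> \<beta> k) v) +
    (\<Sum>i=m..j. fock_scale (current_coeff \<alpha> \<beta> k i j) (app (psi i) v))"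
proof -
  let ?A = "current_coeff \<alpha> \<beta> k"
  obtain N1 N2 where N1: "\<And>N. N \<ge> N1 \<Longrightarrow> app (current \<alpha> \<beta> k) (app (psi j) v) =
     (\<Sum>i=-N..N. \<Sum>l=-N..N. fock_scale (?A i l) (app (normal_ordered i l) (app (psi j) v)))"
   and N2: "\<And>N. N \<ge> N2 \<Longrightarrow> app (current \<alpha> \<beta> k) v =
     (\<Sum>i=-N..N. \<Sum>l=-N..N. fock_scale (?A i l) (app (normal_ordered i l) v))"
    using current_eventually by meson
  define N where "N = max (max N1 N2) (max \<bar>j\<bar> \<bar>m\<bar>)"
  have N: "N \<ge> N1" "N \<ge> N2" "\<bar>j\<bar> \<le> N" "\<bar>m\<bar> \<le> N" by (auto simp: N_def)
  \<comment> \<open>the constants subtracted by normal ordering are central and do not contribute\<close>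
  have comm: "fock_scale (?A i l) (app (normal_ordered i l) (app (psi j) v)) =
      app (psi j) (fock_scale (?A i l) (app (normal_ordered i l) v)) +
      (if l = j then fock_scale (?A i l) (app (psi i) v) else 0)" for i l
  proof -
    have "app (normal_ordered i l) (app (psi j) v) =
        app (psi j) (app (normal_ordered i l) v) + app (if l = j then psi i else 0) v"
      unfolding app_times [symmetric] normal_ordered_psi app_plus by simp
    then show ?thesis by (simp add: app_scale fock.scale_right_distrib)
  qed
  have "app (current \<alpha> \<beta> k) (app (psi j) v) =
      app (psi j) (app (current \<alpha> \<beta> k) v) +
      (\<Sum>i=-N..N. \<Sum>l=-N..N. if l = j then fock_scale (?A i l) (app (psi i) v) else 0)"
    unfolding N1 [OF N(1)] N2 [OF N(2)] comm by (simp add: sum.distrib app_sum)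
  also have "(\<Sum>i=-N..N. \<Sum>l=-N..N. if l = j then fock_scale (?A i l) (app (psi i) v) else 0) =
      (\<Sum>i=-N..N. fock_scale (?A i j) (app (psi i) v))"
    using N(3) by (intro sum.cong) auto
  also have "\<dots> = (\<Sum>i=m..j. fock_scale (?A i j) (app (psi i) v))"
    using N by (intro sum.mono_neutral_right) (auto simp: low current_coeff_below)
  finally show ?thesis .
qed

lemma psi_vacuum: "i \<le> m \<Longrightarrow> app (psi i) (fock_basis (maya_vacuum m)) = 0"
  by (simp add: psi_basis maya_vacuum.rep_eq)

lemma psi_star_vacuum: "m < i \<Longrightarrow> app (psi_star i) (fock_basis (maya_vacuum m)) = 0"
  by (simp add: psi_star_basis maya_vacuum.rep_eq)

definition vacuum :: "nat \<Rightarrow> fock"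
  where "vacuum n = fock_basis (maya_vacuum (- int n))"

text \<open>
  Off the diagonal \<open>J\<^sub>k\<close> moves a particle to a smaller index, which is impossible in a vacuum.
  On the diagonal, normal ordering leaves \<open>-1\<close> for each empty site in \<open>{1-n..0}\<close>.
\<close>

lemma current_vacuum:
  "app (current \<alpha> \<beta> k) (vacuum n) = fock_scale (- (\<Sum>i=1 - int n..0. \<beta> i ^ k)) (vacuum n)"
proof -
  obtain N0 where N0: "\<And>N. N \<ge> N0 \<Longrightarrow> app (current \<alpha> \<beta> k) (vacuum n) =
     (\<Sum>i=-N..N. \<Sum>l=-N..N. fock_scale (current_coeff \<alpha> \<beta> k i l) (app (normal_ordered i l) (vacuum n)))"
    using current_eventually by meson
  define N where "N = max N0 (int n)"
  have N: "N \<ge> N0" "N \<ge> int n" by (auto simp: N_def)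
  have diag: "fock_scale (current_coeff \<alpha> \<beta> k i l) (app (normal_ordered i l) (vacuum n)) =
     (if l = i then if i \<in> {1 - int n..0} then fock_scale (- (\<beta> i ^ k)) (vacuum n) else 0 else 0)" for i l
  proof (cases i l rule: linorder_cases)
    case less
    have "app (psi i) (app (psi_star l) (vacuum n)) = 0"
    proof (cases "- int n < l")
      case True
      then show ?thesis by (simp add: vacuum_def psi_star_vacuum)
    next
      case False
      have "psi i * psi_star l = - (psi_star l * psi i)" using less by (simp add: psi_star_psi)
      then have "app (psi i) (app (psi_star l) (vacuum n)) = - app (psi_star l) (app (psi i) (vacuum n))"
        by (metis app_times app_uminus)
      then show ?thesis using less False by (simp add: vacuum_def psi_vacuum)
    qed
    then show ?thesis using less by (simp add: normal_ordered_eq app_times)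
  next
    case greater
    then show ?thesis by (simp add: current_coeff_below)
  next
    case equal
    show ?thesis
    proof (cases "- int n < i")
      case True
      then show ?thesis using equal
        by (simp add: normal_ordered_eq current_coeff_diagonal minus_fock_op.rep_eq app_times vacuum_def
           psi_star_vacuum fock.scale_minus_left fock.scale_minus_right)
    next
      case False
      then show ?thesis using equal
        by (simp add: normal_ordered_def app_uminus app_times vacuum_def psi_vacuum)
    qed
  qed
  have "app (current \<alpha> \<beta> k) (vacuum n) =
      (\<Sum>i=-N..N. if i \<in> {1 - int n..0} then fock_scale (- (\<beta> i ^ k)) (vacuum n) else 0)"
    unfolding N0 [OF N(1)] diag by (intro sum.cong) auto
  also have "\<dots> = (\<Sum>i=1 - int n..0. fock_scale (- (\<beta> i ^ k)) (vacuum n))"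
    using N by (intro sum.mono_neutral_cong_right) auto
  finally show ?thesis by (simp add: fock.scale_sum_left sum_negf)
qed

definition fermion_word :: "nat \<Rightarrow> int list \<Rightarrow> fock"
  where "fermion_word n xs = app (prod_list (map psi xs)) (vacuum n)"

lemma fermion_word_Nil: "fermion_word n [] = vacuum n"
  by (simp add: fermion_word_def)

lemma fermion_word_Cons: "fermion_word n (x # xs) = app (psi x) (fermion_word n xs)"
  by (simp add: fermion_word_def app_times)

lemma psi_fermion_word: "i \<le> - int n \<Longrightarrow> app (psi i) (fermion_word n xs) = 0"
proof (induction xs)
  case Nil then show ?case by (simp add: fermion_word_Nil vacuum_def psi_vacuum)
next
  case (Cons x xs)
  have "app (psi i) (app (psi x) v) = - app (psi x) (app (psi i) v)" for v
    by (metis app_times app_uminus psi_anticommute)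
  then show ?case using Cons by (simp add: fermion_word_Cons)
qed

lemma current_fermion_word:
  "app (current \<alpha> \<beta> k) (fermion_word n xs) =
     fock_scale (- (\<Sum>i=1 - int n..0. \<beta> i ^ k)) (fermion_word n xs) +
     (\<Sum>a<length xs. \<Sum>i=1 - int n..xs ! a.
        fock_scale (current_coeff \<alpha> \<beta> k i (xs ! a)) (fermion_word n (xs[a := i])))"
proof (induction xs)
  case Nil
  then show ?case by (simp add: fermion_word_Nil current_vacuum)
next
  case (Cons x xs)
  have "app (current \<alpha> \<beta> k) (fermion_word n (x # xs)) =
      app (psi x) (app (current \<alpha> \<beta> k) (fermion_word n xs)) +
      (\<Sum>i=1 - int n..x. fock_scale (current_coeff \<alpha> \<beta> k i x) (app (psi i) (fermion_word n xs)))"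
    unfolding fermion_word_Cons by (rule current_psi) (simp add: psi_fermion_word)
  then show ?case unfolding Cons
    by (simp only: app_add app_sum app_scale fermion_word_Cons [symmetric] length_Cons
       sum.lessThan_Suc_shift nth_Cons_0 nth_Cons_Suc list_update_code) (simp add: add_ac)
qed

definition fermion_state :: "nat \<Rightarrow> (nat \<Rightarrow> int) \<Rightarrow> fock"
  where "fermion_state n j = fermion_word n (map j [1..<n+1])"

lemma ket_eq_fermion_state: "ket n l = fermion_state n (\<lambda>i. l i - int i + 1)"
proof -
  have "foldr (\<lambda>i. app (psi (f i))) is v = app (prod_list (map psi (map f is))) v" for f "is" v
    by (induction "is") (simp_all add: app_times)
  then show ?thesis by (simp only: ket_def fermion_state_def fermion_word_def vacuum_def)
qed

lemma current_fermion_state: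
  "app (current \<alpha> \<beta> k) (fermion_state n j) =
     fock_scale (- (\<Sum>i=1 - int n..0. \<beta> i ^ k)) (fermion_state n j) +
     (\<Sum>a=1..n. \<Sum>i=1 - int n..j a.
        fock_scale (current_coeff \<alpha> \<beta> k i (j a)) (fermion_state n (j(a := i))))"
proof -
  have *: "(\<Sum>a<n. \<Sum>i=1 - int n..map j [1..<n+1] ! a. fock_scale (current_coeff \<alpha> \<beta> k i (map j [1..<n+1] ! a))
        (fermion_word n ((map j [1..<n+1])[a := i]))) =
    (\<Sum>a=1..n. \<Sum>i=1 - int n..j a. fock_scale (current_coeff \<alpha> \<beta> k i (j a)) (fermion_state n (j(a := i))))"
  proof (rule sum.reindex_bij_witness [where i = "\<lambda>a. a - 1" and j = Suc])
    fix a assume a: "a \<in> {..<n}"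
    have "map (j(Suc a := i)) [1..<n+1] = (map j [1..<n+1])[a := i]" for i
      by (rule nth_equalityI) (use a in \<open>auto simp: nth_list_update simp del: upt_Suc\<close>)
    then show "(\<Sum>i=1 - int n..j (Suc a). fock_scale (current_coeff \<alpha> \<beta> k i (j (Suc a)))
          (fermion_state n (j(Suc a := i)))) =
        (\<Sum>i=1 - int n..map j [1..<n+1] ! a. fock_scale (current_coeff \<alpha> \<beta> k i (map j [1..<n+1] ! a))
          (fermion_word n ((map j [1..<n+1])[a := i])))"
      using a by (simp add: fermion_state_def del: upt_Suc)
  qed auto
  have "length (map j [1..<n+1]) = n" by simp
  then show ?thesis
    unfolding fermion_state_def [of n j] current_fermion_word by (simp only: *)
qed

definition amplitude :: "nat \<Rightarrow> fock_op \<Rightarrow> (nat \<Rightarrow> int) \<Rightarrow> complex"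
  where "amplitude n T j = Poly_Mapping.lookup (app T (fermion_state n j)) (maya_vacuum 0)"

lemma amplitude_scaleR: "amplitude n (c *\<^sub>R T) j = of_real c * amplitude n T j"
  by (simp add: amplitude_def app_scaleR fock_scale.rep_eq)

lemma amplitude_sum: "amplitude n (\<Sum>i\<in>I. T i) j = (\<Sum>i\<in>I. amplitude n (T i) j)"
  by (simp add: amplitude_def app_sum_op lookup_sum)

lemma amplitude_current:
  "amplitude n (T * current \<alpha> \<beta> k) j =
     (\<Sum>a=1..n. \<Sum>i=1 - int n..j a. current_coeff \<alpha> \<beta> k i (j a) * amplitude n T (j(a := i))) -
     (\<Sum>i=1 - int n..0. \<beta> i ^ k) * amplitude n T j"
  by (simp add: amplitude_def app_times current_fermion_state app_diff app_sum app_scale lookup_minus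
     lookup_sum fock_scale.rep_eq)

lemma amplitude_alternating:
  assumes "1 \<le> c" "c < n"
  shows "amplitude n 1 (j \<circ> Transposition.transpose c (Suc c)) = - amplitude n 1 j"
proof -
  let ?t = "Transposition.transpose c (Suc c)"
  have split: "[1..<n+1] = [1..<c] @ [c, Suc c] @ [c+2..<n+1]"
  proof -
    have "[1..<n+1] = [1..<c] @ [c..<n+1]" using assms upt_add_eq_append [of 1 c "n + 1 - c"] by simp
    moreover have "[c..<n+1] = c # Suc c # [c+2..<n+1]" using assms by (simp add: upt_conv_Cons)
    ultimately show ?thesis by simp
  qed
  let ?P = "\<lambda>is. prod_list (map (\<lambda>i. psi (j i)) is)"
  have same: "map (\<lambda>i. psi ((j \<circ> ?t) i)) [1..<c] = map (\<lambda>i. psi (j i)) [1..<c]"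
     "map (\<lambda>i. psi ((j \<circ> ?t) i)) [c+2..<n+1] = map (\<lambda>i. psi (j i)) [c+2..<n+1]"
    by (auto simp: Transposition.transpose_def)
  have "prod_list (map (\<lambda>i. psi ((j \<circ> ?t) i)) [1..<n+1]) =
      ?P [1..<c] * ((psi (j (Suc c)) * psi (j c)) * ?P [c+2..<n+1])"
    unfolding split map_append prod_list.append same by (simp add: mult.assoc)
  also have "\<dots> = - ?P [1..<n+1]"
    unfolding psi_anticommute [of "j (Suc c)" "j c"] split map_append prod_list.append
    by (simp add: mult.assoc)
  finally have "prod_list (map psi (map (j \<circ> ?t) [1..<n+1])) = - prod_list (map psi (map j [1..<n+1]))"
    by (simp only: map_map comp_def)
  then show ?thesis
    by (simp only: amplitude_def fermion_state_def fermion_word_def app_uminus app_one lookup_uminus)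
qed

text \<open>
  A particle created at a positive index by the leftmost operator cannot be present in \<open>|\<emptyset>\<rangle>\<close>.
\<close>

lemma amplitude_first_0:
  assumes "1 \<le> n" "1 \<le> j 1"
  shows "amplitude n 1 j = 0"
proof -
  have "Poly_Mapping.lookup (app (psi x) v) (maya_vacuum 0) = 0" if "1 \<le> x" for x v
  proof (induction v rule: fock_induct)
    case (basis c S)
    have "maya_insert x S \<noteq> maya_vacuum 0"
      using that by (metis atMost_iff insertI1 maya_insert.rep_eq maya_vacuum.rep_eq not_one_le_zero order_trans)
    then show ?case
      by (simp add: app_scale psi_basis fock_scale.rep_eq) (simp add: fock_basis_def lookup_single when_def)
  qed (simp add: app_add lookup_add)
  moreover have "fermion_state n j = app (psi (j 1)) (fermion_word n (map j [2..<n+1]))"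
    using assms(1) by (simp add: fermion_state_def upt_conv_Cons fermion_word_Cons numeral_2_eq_2 del: upt_Suc)
  ultimately show ?thesis using assms(2) by (simp add: amplitude_def)
qed

lemma fermion_state_Suc:
  "fermion_state (Suc n) j = app (prod_list (map psi (map j [1..<n+1]))) (app (psi (j (Suc n))) (vacuum (Suc n)))"
  by (simp add: fermion_state_def fermion_word_def app_times)

lemma amplitude_last_0: "j (Suc n) \<le> - int (Suc n) \<Longrightarrow> amplitude (Suc n) 1 j = 0"
  by (simp add: amplitude_def fermion_state_Suc vacuum_def psi_vacuum)

lemma amplitude_last: "j (Suc n) = - int n \<Longrightarrow> amplitude (Suc n) 1 j = amplitude n 1 j"
proof -
  assume j: "j (Suc n) = - int n"
  have "maya_insert (- int n) (maya_vacuum (- int (Suc n))) = maya_vacuum (- int n)"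
    by (rule maya_eqI) (auto simp: maya_insert.rep_eq maya_vacuum.rep_eq)
  moreover have "wedge_sign (- int n) (maya_vacuum (- int (Suc n))) = 1"
  proof -
    have "{s \<in> occupied (maya_vacuum (- int (Suc n))). - int n < s} = {}"
      by (auto simp: maya_vacuum.rep_eq)
    then show ?thesis unfolding wedge_sign_def by (simp only: card.empty power_0)
  qed
  moreover have "- int n \<notin> occupied (maya_vacuum (- int (Suc n)))" by (simp add: maya_vacuum.rep_eq)
  ultimately have "app (psi (- int n)) (vacuum (Suc n)) = vacuum n"
    unfolding vacuum_def psi_basis by (simp only: if_False fock.scale_one)
  then show ?thesis by (simp add: amplitude_def fermion_state_Suc j) (simp add: fermion_state_def fermion_word_def)
qed

section \<open>The vacuum amplitude as a torus integral\<close>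

context separating_circle
begin

text \<open>
  The constant terms. The three cases of the induction step are: an index outside \<open>{-n..0}\<close>, which
  annihilates the vacuum at the left or the right end of the word and makes an inner integral vanish;
  the index \<open>-n\<close>, which lowers the number of variables; and otherwise a repeated index, as \<open>n + 1\<close>
  indices lie in a set of \<open>n\<close> elements.
\<close>

lemma amplitude_eq_pairing:
  "amplitude n 1 j = vandermonde_norm n * pairing n (vandermonde n) j"
proof (induction n arbitrary: j)
  case 0
  have "{(i, k). 1 \<le> i \<and> i < k \<and> k \<le> (0 :: nat)} = {}" by auto
  then have "vandermonde_norm 0 = 1" "vandermonde 0 z = 1" for z
    unfolding vandermonde_norm_def vandermonde_def by (simp_all only: prod.empty)
  then show ?case
    by (simp add: amplitude_def fermion_state_def fermion_word_def vacuum_def fock_basis_def pairing_def)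
next
  case (Suc n)
  let ?N = "Suc n"
  let ?p = "pairing ?N (vandermonde ?N)"
  have amp_swap: "amplitude ?N 1 (j \<circ> Transposition.transpose a b) = - amplitude ?N 1 j"
    if "1 \<le> a" "a < b" "b \<le> ?N" for a b j
    by (rule alternating_transpose [OF amplitude_alternating that])
  have pair_swap: "?p (j \<circ> Transposition.transpose a b) = - ?p j" if "1 \<le> a" "a < b" "b \<le> ?N" for a b j
    by (rule alternating_transpose [OF pairing_vandermonde_alternating that])
  consider (bad) a where "a \<in> {1..?N}" "1 \<le> j a \<or> j a \<le> - int ?N"
    | (lowest) a where "a \<in> {1..?N}" "j a = - int n"
    | (inner) "\<forall>a\<in>{1..?N}. - int n < j a \<and> j a \<le> 0"
    by fastforce
  then show ?case
  proof cases
    case bad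
    have "?p j = 0"
    proof (cases "a = ?N")
      case True
      then show ?thesis using bad pairing_vandermonde_last_0 by blast
    next
      case False
      have "?p (j \<circ> Transposition.transpose a ?N) = 0"
        using bad by (intro pairing_vandermonde_last_0) simp
      then show ?thesis using pair_swap [of a ?N j] bad False by simp
    qed
    moreover have "amplitude ?N 1 j = 0" if "1 \<le> j a"
    proof (cases "a = 1")
      case True
      then show ?thesis using that amplitude_first_0 by simp
    next
      case False
      have "amplitude ?N 1 (j \<circ> Transposition.transpose 1 a) = 0"
        using that by (intro amplitude_first_0) simp_all
      then show ?thesis using amp_swap [of 1 a j] bad False by simp
    qed
    moreover have "amplitude ?N 1 j = 0" if "j a \<le> - int ?N"
    proof (cases "a = ?N")
      case True
      then show ?thesis using that amplitude_last_0 by blast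
    next
      case False
      have "amplitude ?N 1 (j \<circ> Transposition.transpose a ?N) = 0"
        using that by (intro amplitude_last_0) simp
      then show ?thesis using amp_swap [of a ?N j] bad False by simp
    qed
    ultimately show ?thesis using bad by auto
  next
    case lowest
    show ?thesis
    proof (cases "a = ?N")
      case True
      then show ?thesis using lowest Suc.IH [of j] pairing_vandermonde_last [of j n] amplitude_last [of j n] by simp
    next
      case False
      let ?j = "j \<circ> Transposition.transpose a ?N"
      have "?j ?N = - int n" using lowest by simp
      then have "amplitude ?N 1 ?j = vandermonde_norm ?N * ?p ?j"
        by (simp only: pairing_vandermonde_last amplitude_last Suc.IH)
      then show ?thesis using amp_swap [of a ?N j] pair_swap [of a ?N j] lowest False by simp
    qed
  next
    case inner
    have "\<not> inj_on j {1..?N}"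
    proof
      assume "inj_on j {1..?N}"
      then have "card {1..?N} \<le> card {1 - int n..0}"
        using inner by (intro card_inj_on_le [of j]) force+
      then show False by simp
    qed
    then show ?thesis
      using alternating_repeated [of ?N "amplitude ?N 1" j, OF amplitude_alternating]
        alternating_repeated [of ?N ?p j, OF pairing_vandermonde_alternating] by simp
  qed
qed

text \<open>
  The coefficients of the combined exponent \<open>\<Lambda>\<^bsub>-n\<^esub> + \<Sum>\<^sub>i \<xi>(z\<^sub>i)\<close>.
\<close>

definition power_sum_shifted :: "nat \<Rightarrow> (nat \<Rightarrow> complex) \<Rightarrow> nat \<Rightarrow> complex"
  where "power_sum_shifted n z k = (\<Sum>a=1..n. z a ^ k) - (\<Sum>i=1 - int n..0. \<beta> i ^ k)"

lemma polynomial_fun_power_sum_shifted: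
  assumes "polynomial_fun n P"
  shows "polynomial_fun n (\<lambda>z. power_sum_shifted n z k * P z)"
proof -
  have "polynomial_fun n (\<lambda>z. (\<Sum>a=1..n. z a ^ k * P z) + (- (\<Sum>i=1 - int n..0. \<beta> i ^ k)) * P z)"
    using assms by (intro polynomial_fun.add polynomial_fun.scale polynomial_fun_sum polynomial_fun_coordinate) auto
  then show ?thesis by (simp add: power_sum_shifted_def left_diff_distrib sum_distrib_right)
qed

text \<open>The same expression as in \<open>amplitude_current\<close>.\<close>

lemma pairing_power_sum_shifted:
  assumes "polynomial_fun n P"
  shows "pairing n (\<lambda>z. power_sum_shifted n z k * P z) j =
     (\<Sum>a=1..n. \<Sum>i=1 - int n..j a. current_coeff \<alpha> \<beta> k i (j a) * pairing n P (j(a := i))) -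
     (\<Sum>i=1 - int n..0. \<beta> i ^ k) * pairing n P j"
proof -
  let ?L = "\<Sum>i=1 - int n..0. \<beta> i ^ k"
  have c: "polynomial_fun n (\<lambda>z. z a ^ k * P z)" if "a \<in> {1..n}" for a
    using assms that by (rule polynomial_fun_coordinate)
  have "(\<lambda>z. power_sum_shifted n z k * P z) = (\<lambda>z. (\<Sum>a=1..n. z a ^ k * P z) + (- ?L) * P z)"
    by (simp add: power_sum_shifted_def left_diff_distrib sum_distrib_right)
  then have "pairing n (\<lambda>z. power_sum_shifted n z k * P z) j =
      pairing n (\<lambda>z. \<Sum>a=1..n. z a ^ k * P z) j + (- ?L) * pairing n P j"
    using c assms by (simp only: pairing_add polynomial_fun_sum polynomial_fun.scale pairing_scale finite_atLeastAtMost)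
  also have "pairing n (\<lambda>z. \<Sum>a=1..n. z a ^ k * P z) j = (\<Sum>a=1..n. pairing n (\<lambda>z. z a ^ k * P z) j)"
    using c by (intro pairing_sum) auto
  also have "\<dots> = (\<Sum>a=1..n. \<Sum>i=1 - int n..j a. current_coeff \<alpha> \<beta> k i (j a) * pairing n P (j(a := i)))"
    by (intro sum.cong refl pairing_coordinate_power [symmetric] assms)
  finally show ?thesis by simp
qed

text \<open>
  The generating function without its one-variable rational factors, at the monomial \<open>M\<close>.
\<close>

definition schur_kernel :: "nat \<Rightarrow> nat multiset \<Rightarrow> (nat \<Rightarrow> complex) \<Rightarrow> complex"
  where "schur_kernel n M z = pcoeff (pexp (plinear (power_sum_shifted n z))) M * (vandermonde_norm n * vandermonde n z)"

lemma schur_kernel_recursion: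
  "of_nat (size M) * schur_kernel n M z =
     (\<Sum>k\<in>set_mset M. inverse (of_nat k) * (power_sum_shifted n z k * schur_kernel n (M - {#k#}) z))"
proof -
  have "of_nat (size M) * schur_kernel n M z =
      (real (size M) *\<^sub>R pcoeff (pexp (plinear (power_sum_shifted n z))) M) * (vandermonde_norm n * vandermonde n z)"
    by (simp add: schur_kernel_def scaleR_conv_of_real)
  then show ?thesis
    unfolding pexp_plinear_recursion sum_distrib_right schur_kernel_def
    by (simp only:) (intro sum.cong refl, simp add: scaleR_conv_of_real mult_ac)
qed

lemma polynomial_fun_schur_kernel: "polynomial_fun n (schur_kernel n M)"
proof (induction "size M" arbitrary: M)
  case 0
  then have "schur_kernel n M = (\<lambda>z. vandermonde_norm n * vandermonde n z)"
    by (simp add: schur_kernel_def pcoeff_pexp_plinear_empty fun_eq_iff)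
  then show ?case by (simp add: polynomial_fun.scale polynomial_fun_vandermonde)
next
  case (Suc N)
  have "polynomial_fun n (schur_kernel n (M - {#k#}))" if "k \<in># M" for k
    using Suc that by (intro Suc.hyps(1)) (simp add: size_Diff_singleton)
  then have "polynomial_fun n (\<lambda>z. inverse (of_nat (size M)) *
      (\<Sum>k\<in>set_mset M. inverse (of_nat k) * (power_sum_shifted n z k * schur_kernel n (M - {#k#}) z)))"
    by (intro polynomial_fun.scale polynomial_fun_sum polynomial_fun_power_sum_shifted) auto
  moreover have "inverse c * (c * y) = y" if "c \<noteq> 0" for c y :: complex using that by simp
  moreover have "of_nat (size M) \<noteq> (0 :: complex)" using Suc by auto
  ultimately show ?case
    unfolding schur_kernel_recursion [symmetric] by (simp only: simp_thms)
qed

text \<open>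
  Induction on the degree: amplitude and pairing satisfy the same recursion for all \<open>j\<close>
  simultaneously, and agree in degree zero.
\<close>

lemma amplitude_exp_eq_pairing:
  "amplitude n (pcoeff (pexp (H_plus \<alpha> \<beta>)) M) j = pairing n (schur_kernel n M) j"
proof (induction "size M" arbitrary: M j)
  case 0
  then have "schur_kernel n M = (\<lambda>z. vandermonde_norm n * vandermonde n z)"
    by (simp add: schur_kernel_def pcoeff_pexp_plinear_empty fun_eq_iff)
  then show ?case using 0
    by (simp add: H_plus_def pcoeff_pexp_plinear_empty amplitude_eq_pairing pairing_scale polynomial_fun_vandermonde)
next
  case (Suc N)
  have M: "of_nat (size M) \<noteq> (0 :: complex)" using Suc(2) by (metis nat.distinct(1) of_nat_eq_0_iff)
  let ?E = "\<lambda>M. pcoeff (pexp (H_plus \<alpha> \<beta>)) M"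
  have IH: "amplitude n (?E (M - {#k#})) j = pairing n (schur_kernel n (M - {#k#})) j" if "k \<in># M" for k j
    using Suc that by (intro Suc.hyps(1)) (simp add: size_Diff_singleton)
  have step: "amplitude n (?E (M - {#k#}) * current \<alpha> \<beta> k) j =
      pairing n (\<lambda>z. power_sum_shifted n z k * schur_kernel n (M - {#k#}) z) j" if "k \<in># M" for k
    unfolding amplitude_current pairing_power_sum_shifted [OF polynomial_fun_schur_kernel] IH [OF that] ..
  have "of_nat (size M) * amplitude n (?E M) j = amplitude n (real (size M) *\<^sub>R ?E M) j"
    by (simp add: amplitude_scaleR)
  also have "\<dots> = (\<Sum>k\<in>set_mset M. inverse (of_nat k) * amplitude n (?E (M - {#k#}) * current \<alpha> \<beta> k) j)"
    unfolding H_plus_def pexp_plinear_recursion by (simp add: amplitude_sum amplitude_scaleR)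
  also have "\<dots> = (\<Sum>k\<in>set_mset M. inverse (of_nat k) *
      pairing n (\<lambda>z. power_sum_shifted n z k * schur_kernel n (M - {#k#}) z) j)"
    by (intro sum.cong refl) (simp add: step)
  also have "\<dots> = pairing n (\<lambda>z. \<Sum>k\<in>set_mset M. inverse (of_nat k) *
      (power_sum_shifted n z k * schur_kernel n (M - {#k#}) z)) j"
    by (simp add: pairing_sum pairing_scale polynomial_fun.scale polynomial_fun_power_sum_shifted
         polynomial_fun_schur_kernel)
  also have "\<dots> = pairing n (\<lambda>z. of_nat (size M) * schur_kernel n M z) j"
    by (simp only: schur_kernel_recursion)
  also have "\<dots> = of_nat (size M) * pairing n (schur_kernel n M) j"
    by (rule pairing_scale [OF polynomial_fun_schur_kernel])
  finally show ?case using M by simp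
qed

end

section \<open>The generating function\<close>

lemma int_bidirectional_induct:
  fixes P :: "int \<Rightarrow> bool"
  assumes "P 0" "\<And>k. P k \<longleftrightarrow> P (k + 1)"
  shows "P k"
proof (induction k rule: int_induct [where k = 0])
  case (step2 i)
  then show ?case using assms(2) [of "i - 1"] by simp
qed (use assms in auto)

lemma mpow_shift:
  assumes A: "\<And>i. 1 - z * \<alpha> i \<noteq> 0"
  shows "mpow z (shift c \<alpha>) k = mpow z \<alpha> (k + c) / mpow z \<alpha> c"
proof (induction k rule: int_bidirectional_induct)
  case 1
  show ?case using mpow_nonzero [OF A, where k = c] by (simp add: mpow_def [of z "shift c \<alpha>"])
next
  case (2 k)
  have A': "1 - z * shift c \<alpha> i \<noteq> 0" for i using A by (simp add: shift_def)
  have "mpow z (shift c \<alpha>) (k + 1) = mpow z (shift c \<alpha>) k * (1 - z * \<alpha> (k + 1 + c))"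
    using mpow_Suc [OF A', where k = k] by (simp add: shift_def)
  moreover have "mpow z \<alpha> (k + 1 + c) / mpow z \<alpha> c = mpow z \<alpha> (k + c) / mpow z \<alpha> c * (1 - z * \<alpha> (k + 1 + c))"
    using mpow_Suc [OF A, where k = "k + c"] by (simp add: add_ac)
  ultimately show ?case using A [of "k + 1 + c"] by (simp only: mult_cancel_right simp_thms)
qed

lemma apow_shift:
  assumes B: "\<And>i. z - \<beta> i \<noteq> 0"
  shows "apow z (shift c \<beta>) k = apow z \<beta> (k + c) / apow z \<beta> c"
proof (induction k rule: int_bidirectional_induct)
  case 1
  show ?case using apow_nonzero [OF B, where k = c] by (simp add: apow_def [of z "shift c \<beta>"])
next
  case (2 k)
  have B': "z - shift c \<beta> i \<noteq> 0" for i using B by (simp add: shift_def)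
  have "apow z (shift c \<beta>) (k + 1) = apow z (shift c \<beta>) k * (z - \<beta> (k + 1 + c))"
    using apow_Suc [OF B', where k = k] by (simp add: shift_def)
  moreover have "apow z \<beta> (k + 1 + c) / apow z \<beta> c = apow z \<beta> (k + c) / apow z \<beta> c * (z - \<beta> (k + 1 + c))"
    using apow_Suc [OF B, where k = "k + c"] by (simp add: add_ac)
  ultimately show ?case using B [of "k + 1 + c"] by (simp only: mult_cancel_right simp_thms)
qed

text \<open>
  The shifts by \<open>1 - i\<close> and \<open>-i\<close> multiply the dual shifted power of index \<open>l - i\<close> by
  \<open>(z|\<beta>)\<^bsup>-i\<^esup> / (z;\<alpha>)\<^bsup>1-i\<^esup>\<close>, the inverse of a factor of the generating function. What remains depends on
  \<open>l\<close> and \<open>i\<close> only through \<open>l - i\<close>.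
\<close>

lemma (in separating_circle) weight_eq_shifted_dual:
  assumes "cmod z = r"
  shows "apow z \<beta> (- int n) * mpow z \<alpha> (1 - int i) / apow z \<beta> (- int i) *
      shifted_dual (shift (1 - int i) \<alpha>) (shift (- int i) \<beta>) l z = weight n (l - int i + 1) z"
proof -
  have A: "\<And>i. 1 - z * \<alpha> i \<noteq> 0" and B: "\<And>i. z - \<beta> i \<noteq> 0"
    using assms by (auto simp: alpha_factor_eq beta_factor_eq)
  have "mpow z (shift (1 - int i) \<alpha>) (l - 1) = mpow z \<alpha> (l - int i) / mpow z \<alpha> (1 - int i)"
    by (simp add: mpow_shift [OF A])
  moreover have "apow z (shift (- int i) \<beta>) (l + 1) = apow z \<beta> (l - int i + 1) / apow z \<beta> (- int i)"
    by (simp add: apow_shift [OF B] algebra_simps)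
  moreover have "mpow z \<alpha> (1 - int i) \<noteq> 0" "apow z \<beta> (- int i) \<noteq> 0"
    using A B mpow_nonzero apow_nonzero by blast+
  ultimately show ?thesis
    by (simp add: shifted_dual_def weight_def shift_def algebra_simps)
qed

theorem corollary5p5:
  fixes \<alpha> \<beta> :: "int \<Rightarrow> complex" and r :: real and n :: nat
  assumes "\<And>a. cmod (\<beta> a) < r"
    and "\<And>b. r * cmod (\<alpha> b) < 1"
    and "1 \<le> n"
  shows "has_shifted_expansion r n
    (\<lambda>i. shift (1 - int i) \<alpha>) (\<lambda>i. shift (- int i) \<beta>)
    (double_factorial_schur n \<alpha> \<beta>)
    (\<lambda>z. pexp (Lambda_neg n \<beta>) *
      (\<Prod>i=1..n. pexp (xi (z i)) *
        pconst (apow (z i) \<beta> (- int n) * mpow (z i) \<alpha> (1 - int i) / apow (z i) \<beta> (- int i))) *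
      (\<Prod>(i, j)\<in>{(i, j). 1 \<le> i \<and> i < j \<and> j \<le> n}.
        pconst ((z i - z j) * (1 - \<alpha> (1 - int i) * \<beta> (1 - int j)))))"
    (is "has_shifted_expansion r n ?a ?b ?s ?F")
proof -
  interpret separating_circle \<alpha> \<beta> r by standard (fact assms)+
  let ?g = "\<lambda>z i. apow (z i) \<beta> (- int n) * mpow (z i) \<alpha> (1 - int i) / apow (z i) \<beta> (- int i)"
  have F: "pcoeff (?F z) M = schur_kernel n M z * (\<Prod>i=1..n. ?g z i)" for z M
  proof -
    have "pexp (Lambda_neg n \<beta>) * (\<Prod>i=1..n. pexp (xi (z i))) = pexp (plinear (power_sum_shifted n z))"
      by (simp only: Lambda_neg_def xi_def plinear_sum plinear_uminus pexp_plinear_sum pexp_plinear_add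
         finite_atLeastAtMost finite_atLeastAtMost_int) (simp add: power_sum_shifted_def [abs_def])
    moreover have "(\<Prod>(i, j)\<in>{(i, j). 1 \<le> i \<and> i < j \<and> j \<le> n}.
        pconst ((z i - z j) * (1 - \<alpha> (1 - int i) * \<beta> (1 - int j)))) =
        pconst (vandermonde n z * vandermonde_norm n)"
      unfolding vandermonde_def vandermonde_norm_def prod.distrib [symmetric] case_prod_unfold
      using finite_pairs [of n] by (subst pconst_prod) (simp_all add: case_prod_unfold)
    ultimately have "?F z = pexp (plinear (power_sum_shifted n z)) * pconst (\<Prod>i=1..n. ?g z i) *
        pconst (vandermonde n z * vandermonde_norm n)"
      by (simp add: prod.distrib pconst_prod mult.assoc [symmetric] del: One_nat_def)
    then show ?thesis by (simp only: pcoeff_mult_pconst schur_kernel_def) (simp only: mult_ac)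
  qed
  have "shifted_coeff r n ?a ?b ?F l = ?s l" for l
  proof (rule pser_eqI)
    fix M
    have "pcoeff (shifted_coeff r n ?a ?b ?F l) M =
        torus_integral r n (\<lambda>z. pcoeff (?F z) M * (\<Prod>i=1..n. shifted_dual (?a i) (?b i) (l i) (z i)))"
      by (simp add: shifted_coeff_def Abs_pser_inverse)
    also have "\<dots> = pairing n (schur_kernel n M) (\<lambda>i. l i - int i + 1)"
      unfolding pairing_def F
    proof (rule torus_integral_cong [OF radius_pos])
      fix z assume z: "cmod (z a) = r" if "a \<in> {1..n}" for a
      have "(\<Prod>i=1..n. ?g z i) * (\<Prod>i=1..n. shifted_dual (?a i) (?b i) (l i) (z i)) =
          (\<Prod>i=1..n. weight n (l i - int i + 1) (z i))"
        unfolding prod.distrib [symmetric]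
        by (intro prod.cong refl weight_eq_shifted_dual z)
      then show "schur_kernel n M z * (\<Prod>i=1..n. ?g z i) * (\<Prod>i=1..n. shifted_dual (?a i) (?b i) (l i) (z i)) =
          schur_kernel n M z * (\<Prod>i=1..n. weight n (l i - int i + 1) (z i))"
        by (simp only: mult.assoc)
    qed
    also have "\<dots> = pcoeff (?s l) M"
      by (simp add: double_factorial_schur_def pser_map.rep_eq ket_eq_fermion_state amplitude_def
         flip: amplitude_exp_eq_pairing)
    finally show "pcoeff (shifted_coeff r n ?a ?b ?F l) M = pcoeff (?s l) M" .
  qed
  then show ?thesis by (simp only: has_shifted_expansion_def) simp
qed

end
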